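(* Let $d$ be a positive square-free integer, $M=\mathbb{Q}(i\sqrt{d})$ with ring of integers $\mathbb{Z}_M$, let $a\in\mathbb{Z}$, let $\alpha$ be a root of $f(x)=x^3-ax^2-(a+3)x-1$, and let $\mathcal{O}$ be the order of $K=M(\alpha)$ with $\mathbb{Z}$-basis $\{1,\alpha,\alpha^2,\omega,\omega\alpha,\omega\alpha^2\}$ (with $\omega$ as in the context). The order $\mathcal{O}$ is monogene (over $\mathbb{Q}$) only for $d=1$ and for the values of $a$ occurring in the list below, that is $a\in\{-3,-2,-1,0\}$; otherwise $\mathcal{O}$ is not monogene. For $d=1$ (so $\omega=i$) and these values of $a$, up to equivalence (i.e. up to sign and translation by elements of $\mathbb{Z}$), the generators of power integral bases of $\mathcal{O}$ are exactly the elements $$y\omega+X_1\alpha+X_2\alpha^2\qquad (y\in\mathbb{Z},\ X_1,X_2\in\mathbb{Z}_M)$$ with $(a,y,X_1,X_2)$ one of the following: $$(-3,1,i+ai,-i),\ (-2,1,i+ai,-i),\ (-1,1,i+ai,-i),\ (0,1,i+ai,-i),$$ $$(-3,2,i+ai,-i),\ (-2,2,i+ai,-i),\ (-1,2,i+ai,-i),\ (0,2,i+ai,-i),$$ $$(-3,1,i,0),\ (-2,1,i,0),\ (-1,1,i,0),\ (0,1,i,0),$$ $$(-3,0,i,0),\ (-2,0,i,0),\ (-1,0,i,0),\ (0,0,i,0),$$ $$(-2,0,-ia,i),\ (-1,-1,-ia,i),\ (0,-2,-ia,i),\ (-3,1,-ia,i),$$ $$(0,-3,-ia,i),\ (-3,0,-ia,i),\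 (-1,-2,-ia,i),\ (-2,-1,-ia,i).$$ (In each quadruple, the symbol $a$ in the third coordinate stands for the value of $a$ in the first coordinate.)
   Context: Let $d$ be a positive square-free integer and $M=\mathbb{Q}(i\sqrt{d})$, with ring of integers $\mathbb{Z}_M$. Set $\omega=i\sqrt{d}$ if $-d\equiv 2,3\pmod 4$, and $\omega=(1+i\sqrt{d})/2$ if $-d\equiv 1\pmod 4$. For a parameter $a\in\mathbb{Z}$ let $f(x)=x^3-ax^2-(a+3)x-1$, let $\alpha$ be a root of $f$, and let $K=M(\alpha)$, a sextic field. Let $\mathcal{O}$ be the order of $K$ with $\mathbb{Z}$-basis $\{1,\alpha,\alpha^2,\omega,\omega\alpha,\omega\alpha^2\}$, i.e. $\mathcal{O}=\mathbb{Z}_M[\alpha]$. The order $\mathcal{O}$ is called monogene (over $\mathbb{Q}$) if $\mathcal{O}=\mathbb{Z}[\vartheta]$ for some $\vartheta\in\mathcal{O}$; in this case $(1,\vartheta,\ldots,\vartheta^5)$ is called a power integral basis of $\mathcal{O}$ and $\vartheta$ is called a generator of it. Two elements $\beta,\gamma\in\mathcal{O}$ are called equivalent if $\beta=b\pm\gamma$ with some $b\in\mathbb{Z}$; if $\beta$ and $\gamma$ are equivalent, then $\beta$ generates a power integral basis if and only if $\gamma$ does, and generators are determined only up to equivalence. *)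

theory Defs
  imports
    Complex_Main
    "HOL-Computational_Algebra.Polynomial"
    "HOL-Computational_Algebra.Squarefree"
begin

text \<open>All number fields are realised as subfields of the complex numbers.\<close>

definition quad_omega :: "nat \<Rightarrow> complex" where
  "quad_omega d =
     (if - int d mod 4 = 1 then (1 + \<i> * of_real (sqrt (real d))) / 2
      else \<i> * of_real (sqrt (real d)))"

definition simplest_cubic :: "int \<Rightarrow> complex poly" where
  "simplest_cubic a = [:- 1, - of_int (a + 3), - of_int a, 1:]"

definition sextic_order :: "nat \<Rightarrow> complex \<Rightarrow> complex set" where
  "sextic_order d \<alpha> =
     {of_int x0 + of_int x1 * \<alpha> + of_int x2 * \<alpha> ^ 2
        + of_int y0 * quad_omega d + of_int y1 * (quad_omega d * \<alpha>)
        + of_int y2 * (quad_omega d * \<alpha> ^ 2) | x0 x1 x2 y0 y1 y2 :: int. True}"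

definition int_adjoin :: "complex \<Rightarrow> complex set" where
  "int_adjoin \<theta> = {poly (map_poly of_int p) \<theta> | p :: int poly. True}"

definition generates_pib :: "complex set \<Rightarrow> complex \<Rightarrow> bool" where
  "generates_pib R \<theta> \<longleftrightarrow> \<theta> \<in> R \<and> R = int_adjoin \<theta>"

definition monogene :: "complex set \<Rightarrow> bool" where
  "monogene R \<longleftrightarrow> (\<exists>\<theta>. generates_pib R \<theta>)"

definition equivalent_elts :: "complex \<Rightarrow> complex \<Rightarrow> bool" where
  "equivalent_elts \<beta> \<gamma> \<longleftrightarrow> (\<exists>b :: int. \<beta> = of_int b + \<gamma> \<or> \<beta> = of_int b - \<gamma>)"

text \<open>The quadruples \<open>(a, y, X\<^sub>1, X\<^sub>2)\<close>; they belong to \<open>d = 1\<close>, so \<open>X\<^sub>1\<close> and \<open>X\<^sub>2\<close> are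
  Gaussian integers.\<close>

definition pib_quadruples :: "(int \<times> int \<times> complex \<times> complex) set" where
  "pib_quadruples =
     (\<lambda>(a, y). (a, y, \<i> + of_int a * \<i>, - \<i>)) `
       {(-3, 1), (-2, 1), (-1, 1), (0, 1),
        (-3, 2), (-2, 2), (-1, 2), (0, 2)}
   \<union> (\<lambda>(a, y). (a, y, \<i>, 0)) `
       {(-3, 1), (-2, 1), (-1, 1), (0, 1),
        (-3, 0), (-2, 0), (-1, 0), (0, 0)}
   \<union> (\<lambda>(a, y). (a, y, - \<i> * of_int a, \<i>)) `
       {(-2, 0), (-1, -1), (0, -2), (-3, 1),
        (0, -3), (-3, 0), (-1, -2), (-2, -1)}"

end

theory Submission
  imports Defs
begin

text \<open>Write a generator as \<open>\<theta> = x\<^sub>0 + x\<^sub>1 \<alpha> + x\<^sub>2 \<alpha>\<^sup>2 + \<omega> \<eta>\<close> with \<open>\<eta> = y\<^sub>0 + y\<^sub>1 \<alpha> + y\<^sub>2 \<alpha>\<^sup>2\<close>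
and integer coefficients. All three roots of the cubic are real and \<open>\<sigma> r = r\<^sup>2 - (a + 1) r - 2\<close> permutes
them cyclically, so \<open>\<theta>\<close> has six conjugates \<open>\<theta>\<^sub>j\<close> and \<open>\<theta>'\<^sub>j\<close>, indexed by the
roots \<open>\<alpha>\<^sub>1, \<alpha>\<^sub>2, \<alpha>\<^sub>3\<close>, where a prime denotes complex conjugation. Put
\<open>\<rho>\<^sub>j = \<theta>\<^sub>j + \<theta>'\<^sub>j\<close>, \<open>\<delta> = \<bar>\<omega> - \<omega>'\<bar>\<^sup>2\<close> and \<open>m = a\<^sup>2 + 3 a + 9\<close>; the discriminant of the cubic is
\<open>m\<^sup>2\<close>, and \<open>m \<ge> 7\<close>.

Suppose that the order equals \<open>\<int>[\<theta>]\<close>. Three facts follow (\<open>rel_index_bound\<close>, \<open>unit_norms\<close>): the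
product of the three differences \<open>\<theta>\<^sub>i - \<theta>\<^sub>j\<close> divides that of the \<open>\<alpha>\<^sub>i - \<alpha>\<^sub>j\<close>; \<open>\<eta>\<close> is a unit; and the
numbers \<open>\<theta>'\<^sub>i - \<theta>\<^sub>j\<close> with \<open>i \<noteq> j\<close> are units. For the last two, an integer polynomial \<open>q\<close> with
\<open>q(\<theta>) = \<omega>\<close> also has \<open>q(\<theta>\<^sub>i) = \<omega>\<close> for all \<open>i\<close>, so \<open>q - \<omega>\<close> is divisible by \<open>\<Prod>(x - \<theta>\<^sub>i)\<close>;
evaluation at \<open>\<theta>'\<^sub>j\<close> shows that \<open>\<Prod>(\<theta>'\<^sub>j - \<theta>\<^sub>i)\<close> divides \<open>\<omega>' - \<omega>\<close>, and the factor with
\<open>i = j\<close> already accounts for that number.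

As the \<open>\<alpha>\<^sub>j\<close> are real, \<open>4 \<bar>\<theta>\<^sub>i - \<theta>\<^sub>j\<bar>\<^sup>2 = (\<rho>\<^sub>i - \<rho>\<^sub>j)\<^sup>2 + \<delta> (\<eta>\<^sub>i - \<eta>\<^sub>j)\<^sup>2\<close>, and
\<open>4 \<bar>\<theta>'\<^sub>i - \<theta>\<^sub>j\<bar>\<^sup>2 = (\<rho>\<^sub>i - \<rho>\<^sub>j)\<^sup>2 + \<delta> (\<eta>\<^sub>i + \<eta>\<^sub>j)\<^sup>2\<close>. A product of three such sums of squares is at least
the sum of the extreme products (\<open>prod_sum_squares_ge\<close>). If \<open>F\<close> denotes the index form of \<open>\<int>[\<alpha>]\<close> and
\<open>k\<close> the product of the \<open>\<eta>\<^sub>i + \<eta>\<^sub>j\<close>, this yields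
\<open>F(\<rho>)\<^sup>2 + \<delta>\<^sup>3 F(\<eta>)\<^sup>2 \<le> 64\<close> and \<open>m\<^sup>2 F(\<rho>)\<^sup>2 + \<delta>\<^sup>3 k\<^sup>2 \<le> 64\<close>, from which \<open>disc_four_of_index_bounds\<close> derives
\<open>\<delta> = 4\<close>, \<open>F(\<rho>) = 0\<close>, \<open>k = \<plusminus>1\<close> and \<open>F(\<eta>) = \<plusminus>1\<close>. Hence \<open>d = 1\<close>, and \<open>\<theta>\<close> is an integer plus \<open>\<i> \<eta>\<close>.

No Thue equation has to be solved to find \<open>\<eta>\<close>. Let \<open>x\<^sup>3 - T x\<^sup>2 + S x - N\<close> be its characteristic polynomial;
after a change of sign \<open>N = 1\<close>. Then \<open>k = T S - 1 = \<plusminus>1\<close>, so \<open>T S\<close> is 0 or 2. Its discriminant is \<open>m\<^sup>2\<close>,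
and its Hessian gives \<open>T\<^sup>2 - 3 S = m Q\<close> with an integer \<open>Q\<close>. If \<open>T S = 0\<close>, eliminating the other coefficient
from these two equations shows that \<open>m\<^sup>2\<close> divides \<open>27\<^sup>2\<close>. In each case (\<open>index_one_unit_charpoly\<close>) the
polynomial is the simplest cubic with parameter \<open>T \<in> {-3, -2, -1, 0}\<close> and the same \<open>m\<close>, that is, with
parameter \<open>a\<close> or \<open>-3 - a\<close>. Its roots are the \<open>\<alpha>\<^sub>j\<close> or the \<open>-1 - \<alpha>\<^sub>j\<close>, so \<open>\<eta>\<close> is \<open>\<plusminus>\<alpha>\<^sub>j\<close> or
\<open>\<plusminus>(\<alpha>\<^sub>j + 1)\<close> (\<open>generator_form\<close>); written in the basis \<open>1, \<alpha>, \<alpha>\<^sup>2\<close>, these are the tabulated elements.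

Conversely, for these \<open>\<eta>\<close> the number \<open>1/\<eta>\<close> is an integer combination of \<open>1, \<eta>\<^sup>2, \<eta>\<^sup>4\<close>. Therefore \<open>\<i>\<close>, and
then \<open>\<eta>\<close> and \<open>\<alpha>\<close>, are integer polynomials in \<open>\<i> \<eta>\<close> (\<open>generator_converse\<close>).\<close>

section \<open>Symmetric functions of the conjugates\<close>

text \<open>The next identities evaluate symmetric functions of \<open>u\<^sub>0 + u\<^sub>1 r\<^sub>i + u\<^sub>2 r\<^sub>i\<^sup>2\<close> over the roots
\<open>r\<^sub>1, r\<^sub>2, r\<^sub>3\<close> of \<open>x\<^sup>3 - a x\<^sup>2 - (a + 3) x - 1\<close>. The roots enter only through Vieta's relations, so that the
identities apply to real and to complex roots alike.\<close>

lemma norm_form_general: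
  fixes r1 r2 r3 u0 u1 u2 :: "'a::comm_ring_1"
  defines "e1 \<equiv> r1+r2+r3" and "e2 \<equiv> r1*r2+r2*r3+r3*r1" and "e3 \<equiv> r1*r2*r3"
  shows "(u0+u1*r1+u2*r1^2)*(u0+u1*r2+u2*r2^2)*(u0+u1*r3+u2*r3^2) =
    u0^3 + u0^2*u1*e1 + u0^2*u2*(e1^2-2*e2) + u0*u1^2*e2 + u0*u1*u2*(e1*e2-3*e3)
     + u0*u2^2*(e2^2-2*e1*e3) + u1^3*e3 + u1^2*u2*e1*e3 + u1*u2^2*e2*e3 + u2^3*e3^2"
  unfolding assms by (simp add: algebra_simps power2_eq_square power3_eq_cube)

lemma norm_form:
  fixes r1 r2 r3 u0 u1 u2 a :: "'a::comm_ring_1"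
  assumes "r1+r2+r3 = a" "r1*r2+r2*r3+r3*r1 = -(a+3)" "r1*r2*r3 = 1"
  shows "(u0+u1*r1+u2*r1^2)*(u0+u1*r2+u2*r2^2)*(u0+u1*r3+u2*r3^2) =
    u0^3 + u0^2*u1*a + u0^2*u2*(a^2+2*a+6) - u0*u1^2*(a+3) - u0*u1*u2*(a^2+3*a+3)
     + u0*u2^2*(a^2+4*a+9) + u1^3 + u1^2*u2*a - u1*u2^2*(a+3) + u2^3"
  unfolding norm_form_general assms by (simp add: algebra_simps power2_eq_square)

text \<open>Irreducibility of the cubic, in the form in which it is used: the conjugates of a nonzero element
do not vanish. The proof is an infinite descent modulo 2.\<close>

lemma norm_form_anisotropic:
  fixes c0 c1 c2 a :: int
  assumes "c0^3 + c0^2*c1*a + c0^2*c2*(a^2+2*a+6) - c0*c1^2*(a+3) - c0*c1*c2*(a^2+3*a+3)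
     + c0*c2^2*(a^2+4*a+9) + c1^3 + c1^2*c2*a - c1*c2^2*(a+3) + c2^3 = 0"
  shows "c0 = 0 \<and> c1 = 0 \<and> c2 = 0"
  using assms
proof (induction "nat (\<bar>c0\<bar>+\<bar>c1\<bar>+\<bar>c2\<bar>)" arbitrary: c0 c1 c2 rule: less_induct)
  case less
  let ?G = "\<lambda>c0 c1 c2. c0^3 + c0^2*c1*a + c0^2*c2*(a^2+2*a+6) - c0*c1^2*(a+3) - c0*c1*c2*(a^2+3*a+3)
     + c0*c2^2*(a^2+4*a+9) + c1^3 + c1^2*c2*a - c1*c2^2*(a+3) + c2^3 :: int"
  \<comment> \<open>Modulo 2 the cubic is \<open>x\<^sup>3 + x + 1\<close> or \<open>x\<^sup>3 + x\<^sup>2 + 1\<close>; both are irreducible, so an even norm forces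
    even coefficients.\<close>
  have "even (?G c0 c1 c2)" using less.prems by simp
  then have "even c0 \<and> even c1 \<and> even c2"
    by (cases "even a"; cases "even c0"; cases "even c1"; cases "even c2"; simp)
  then obtain b0 b1 b2 where b: "c0 = 2*b0" "c1 = 2*b1" "c2 = 2*b2" by (auto elim!: evenE)
  have "?G c0 c1 c2 = 8 * ?G b0 b1 b2" unfolding b by (simp add: algebra_simps power2_eq_square power3_eq_cube)
  then have g: "?G b0 b1 b2 = 0" using less.prems by simp
  show ?case
  proof (rule ccontr)
    assume n: "\<not> ?thesis"
    have "nat (\<bar>b0\<bar>+\<bar>b1\<bar>+\<bar>b2\<bar>) < nat (\<bar>c0\<bar>+\<bar>c1\<bar>+\<bar>c2\<bar>)" using n b by auto
    from less.hyps[OF this g] n b show False by simp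
  qed
qed

lemma trace_form:
  fixes r1 r2 r3 u0 u1 u2 a :: "'a::comm_ring_1"
  assumes "r1+r2+r3 = a" "r1*r2+r2*r3+r3*r1 = -(a+3)"
  shows "(u0+u1*r1+u2*r1^2)+(u0+u1*r2+u2*r2^2)+(u0+u1*r3+u2*r3^2) = 3*u0+u1*a+u2*(a^2+2*a+6)"
proof -
  have "(u0+u1*r1+u2*r1^2)+(u0+u1*r2+u2*r2^2)+(u0+u1*r3+u2*r3^2)
    = 3*u0+u1*(r1+r2+r3)+u2*((r1+r2+r3)^2-2*(r1*r2+r2*r3+r3*r1))"
    by (simp add: algebra_simps power2_eq_square)
  then show ?thesis unfolding assms by (simp add: algebra_simps)
qed

lemma second_symmetric_form:
  fixes r1 r2 r3 u0 u1 u2 a :: "'a::comm_ring_1"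
  assumes "r1+r2+r3 = a" "r1*r2+r2*r3+r3*r1 = -(a+3)" "r1*r2*r3 = 1"
  defines "e \<equiv> \<lambda>r. u0+u1*r+u2*r^2"
  shows "e r1 * e r2 + e r2 * e r3 + e r3 * e r1 =
    3*u0^2+2*u0*u1*a+2*u0*u2*(a^2+2*a+6) - u1^2*(a+3) - u1*u2*(a^2+3*a+3)+u2^2*(a^2+4*a+9)"
proof -
  define e1 e2 e3 where "e1 = r1+r2+r3" and "e2 = r1*r2+r2*r3+r3*r1" and "e3 = r1*r2*r3"
  have "e r1 * e r2 + e r2 * e r3 + e r3 * e r1
     = 3*u0^2 + 2*u0*u1*e1 + 2*u0*u2*(e1^2-2*e2) + u1^2*e2 + u1*u2*(e1*e2-3*e3) + u2^2*(e2^2-2*e1*e3)"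
    unfolding e_def e1_def e2_def e3_def by (simp add: algebra_simps power2_eq_square power3_eq_cube power4_eq_xxxx)
  also have "\<dots> = 3*u0^2+2*u0*u1*a+2*u0*u2*(a^2+2*a+6) - u1^2*(a+3) - u1*u2*(a^2+3*a+3)+u2^2*(a^2+4*a+9)"
   unfolding e1_def e2_def e3_def assms by (simp add: algebra_simps power2_eq_square power3_eq_cube power4_eq_xxxx)
  finally show ?thesis .
qed

text \<open>The left side is half the sum of the squared differences of the conjugates. For simplest cubic
fields this binary quadratic form is \<open>m = a\<^sup>2 + 3 a + 9\<close> times a primitive form; this divisibility
by \<open>m\<close>, compared with the discriminant \<open>m\<^sup>2\<close>, is what makes the final Diophantine problem finite.\<close>

lemma hessian_form:
  fixes r1 r2 r3 u0 u1 u2 a :: "'a::comm_ring_1"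
  assumes "r1+r2+r3 = a" "r1*r2+r2*r3+r3*r1 = -(a+3)" "r1*r2*r3 = 1"
  defines "e \<equiv> \<lambda>r. u0+u1*r+u2*r^2"
  shows "(e r1 + e r2 + e r3)^2 - 3 * (e r1 * e r2 + e r2 * e r3 + e r3 * e r1) = (a^2+3*a+9)*((u1+a*u2)^2 + (u1+a*u2)*u2+u2^2)"
proof -
  define e1 e2 e3 where "e1 = r1+r2+r3" and "e2 = r1*r2+r2*r3+r3*r1" and "e3 = r1*r2*r3"
  have "(e r1 + e r2 + e r3)^2 - 3 * (e r1 * e r2 + e r2 * e r3 + e r3 * e r1)
     = (e1^2-3*e2)*u1^2 + (2*e1^3-7*e1*e2+9*e3)*u1*u2 + (e1^4-4*e1^2*e2+e2^2+6*e1*e3)*u2^2"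
    unfolding e_def e1_def e2_def e3_def by (simp add: algebra_simps power2_eq_square power3_eq_cube power4_eq_xxxx)
  also have "\<dots> = (a^2+3*a+9)*((u1+a*u2)^2 + (u1+a*u2)*u2+u2^2)"
   unfolding e1_def e2_def e3_def assms by (simp add: algebra_simps power2_eq_square power3_eq_cube power4_eq_xxxx)
  finally show ?thesis .
qed

lemma cubic_discriminant:
  fixes x y z :: "'a::comm_ring_1"
  defines "e1 \<equiv> x+y+z" and "e2 \<equiv> x*y+y*z+z*x" and "e3 \<equiv> x*y*z"
  shows "((x-y)*(y-z)*(z-x))^2 = e1^2*e2^2 - 4*e2^3 - 4*e1^3*e3 + 18*e1*e2*e3 - 27*e3^2"
  unfolding assms by (simp add: algebra_simps power2_eq_square power3_eq_cube)

lemma simplest_cubic_discriminant: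
  fixes r1 r2 r3 a :: "'a::comm_ring_1"
  assumes "r1+r2+r3 = a" "r1*r2+r2*r3+r3*r1 = -(a+3)" "r1*r2*r3 = 1"
  shows "((r1-r2)*(r2-r3)*(r3-r1))^2 = (a^2+3*a+9)^2"
  unfolding cubic_discriminant assms by (simp add: algebra_simps power2_eq_square power3_eq_cube)

text \<open>Since \<open>r\<^sub>1 + r\<^sub>2 = a - r\<^sub>3\<close>, each difference of conjugates is the difference of the roots times the
conjugate \<open>X - u\<^sub>2 r\<^sub>3\<close>; the index form is thus the norm of \<open>X - u\<^sub>2 r\<close>.\<close>

lemma index_form:
  fixes r1 r2 r3 u0 u1 u2 a :: "'a::comm_ring_1"
  assumes "r1+r2+r3 = a" "r1*r2+r2*r3+r3*r1 = -(a+3)" "r1*r2*r3 = 1"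
  defines "e \<equiv> \<lambda>r. u0+u1*r+u2*r^2" and "X \<equiv> u1 + a*u2"
  shows "(e r1 - e r2) * (e r2 - e r3) * (e r3 - e r1) =
    ((r1-r2)*(r2-r3)*(r3-r1)) * (X^3 - a*X^2*u2 - (a+3)*X*u2^2 - u2^3)"
proof -
  have d: "e r - e r' = (r-r') * (X - u2 * r'')" if "r+r'+r'' = a" for r r' r''
    unfolding X_def e_def that[symmetric] by (simp add: algebra_simps power2_eq_square)
  have "(e r1 - e r2) * (e r2 - e r3) * (e r3 - e r1) = ((r1-r2)*(r2-r3)*(r3-r1)) * ((X+(-u2)*r1+0*r1^2)*(X+(-u2)*r2+0*r2^2)*(X+(-u2)*r3+0*r3^2))"
    using assms(1) by (simp add: d[of r1 r2 r3] d[of r2 r3 r1] d[of r3 r1 r2] add_ac mult_ac)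
  then show ?thesis unfolding norm_form[OF assms(1-3)] by (simp add: algebra_simps)
qed

section \<open>Diophantine conditions on a generator\<close>

text \<open>A unit of norm 1 in a simplest cubic field, of index 1 and with sums of conjugates that are units
again, is a root of a simplest cubic. Here \<open>T\<close> and \<open>S\<close> are its first two elementary symmetric functions,
\<open>T S - 1\<close> is the norm of the sum of two conjugates, and \<open>Q\<close> comes from \<open>hessian_form\<close>.\<close>

lemma index_one_unit_charpoly:
  fixes T S m Q :: int
  assumes k: "(T*S-1)^2 = 1" and disc: "T^2*S^2 - 4*S^3 - 4*T^3 + 18*T*S - 27 = m^2"
    and Q: "T^2 - 3*S = m*Q" and m: "m \<ge> 7"
  shows "T \<in> {-3,-2,-1,0} \<and> S = -(T+3) \<and> m = T^2+3*T+9"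
proof -
  \<comment> \<open>In the cases \<open>T = 0\<close> and \<open>S = 0\<close> below, \<open>m\<^sup>2\<close> turns out to divide \<open>729\<close>.\<close>
  have m27: "m = 9 \<or> m = 27" if dv: "m^2 dvd 27^2"
  proof -
    have "m dvd 27" using dv pow_divides_pow_iff[of 2 m 27] by linarith
    then obtain k where k: "27 = m*k" by (rule dvdE)
    have "k > 0" using k m zero_less_mult_iff[of m k] by linarith
    moreover have "k < 4" using k m mult_mono[of 7 m 4 k] by (cases "k < 4") auto
    ultimately have "k = 1 \<or> k = 2 \<or> k = 3" by linarith
    then show ?thesis using k by presburger
  qed
  have cube: "m = 9 \<and> x = -3" if x: "4*x^3 + m^2 + 27 = 0" and dv: "m^2 dvd 27^2" for x :: int
    using m27[OF dv]
  proof
    assume m9: "m = 9"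
    have "(x+3)*(x^2-3*x+9) = 0" using x m9 by (simp add: algebra_simps power2_eq_square power3_eq_cube)
    moreover have "x^2-3*x+9 > 0" using zero_le_power2[of "2*x-3"] by (simp add: power2_eq_square algebra_simps)
    ultimately show ?thesis using m9 by auto
  next
    assume m27: "m = 27"
    then have e: "x^3 = -189" using x by simp
    have "x < -5" using e power_mono_odd[of 3 "-5" x] by (cases "x < -5") (auto simp: not_less)
    moreover have "x > -6" using e power_mono_odd[of 3 x "-6"] by (cases "x > -6") (auto simp: not_less)
    ultimately show ?thesis by linarith
  qed
  have "T*S = 0 \<or> T*S = 2" using k by (auto simp: power2_eq_1_iff)
  then consider "T = 0" | "S = 0" | "T*S = 2" by auto
  then show ?thesis
  proof cases
    case 1
    have a: "4*S^3 + m^2 + 27 = 0" using disc 1 by simp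
    \<comment> \<open>The discriminant is now \<open>-4 S\<^sup>3 - 27\<close>, and cubing \<open>-3 S = m Q\<close> eliminates \<open>S\<close>.\<close>
    have mQ: "m*Q = -3*S" using Q 1 by simp
    have "4*(m*Q)^3 = 27 * m^2 + 729"
      unfolding mQ power_mult_distrib using a by simp
    then have "27^2 = m^2 * (4 * m * Q^3 - 27)" by (simp add: power_mult_distrib power2_eq_square power3_eq_cube algebra_simps)
    then have "m = 9 \<and> S = -3" by (rule cube[OF a dvdI])
    then show ?thesis using 1 by simp
  next
    case 2
    have a: "4*T^3 + m^2 + 27 = 0" using disc 2 by simp
    \<comment> \<open>The discriminant is now \<open>-4 T\<^sup>3 - 27\<close>, and cubing \<open>T\<^sup>2 = m Q\<close> eliminates \<open>T\<close>.\<close>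
    have mQ: "m*Q = T^2" using Q 2 by simp
    have "16*(m*Q)^3 = (4*T^3)^2" unfolding mQ power_mult_distrib by (simp flip: power_mult)
    also have "4*T^3 = -(m^2+27)" using a by simp
    finally have "27^2 = m^2 * (16 * m * Q^3 - m^2 - 54)" by (simp add: power_mult_distrib power2_eq_square power3_eq_cube algebra_simps)
    then have "m = 9 \<and> T = -3" by (rule cube[OF a dvdI])
    then show ?thesis using 2 by simp
  next
    case 3
    then have "T dvd 2" by (metis dvd_triv_left)
    then have "\<bar>T\<bar> \<le> 2" using zdvd_imp_le[of "\<bar>T\<bar>" 2] by simp
    then have "T = -2 \<or> T = -1 \<or> T = 0 \<or> T = 1 \<or> T = 2" by auto
    then have "(T = -2 \<and> S = -1) \<or> (T = -1 \<and> S = -2) \<or> (T = 1 \<and> S = 2) \<or> (T = 2 \<and> S = 1)" using 3 by auto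
    moreover have "m^2 = 7^2 \<longrightarrow> m = 7" using m power2_eq_iff_nonneg[of m 7] by simp
    moreover have "m^2 \<noteq> -23" using zero_le_power2[of m] by linarith
    \<comment> \<open>The two positive pairs have discriminant \<open>-23\<close>, the two negative ones \<open>49\<close>.\<close>
    ultimately show ?thesis using disc by auto
  qed
qed

text \<open>In the expanded product every mixed term is a nonnegative multiple of a square.\<close>

lemma prod_sum_squares_ge:
  fixes A1 A2 A3 B1 B2 B3 c :: real
  assumes "c \<ge> 0"
  shows "(A1*A2*A3)^2 + c^3 * (B1*B2*B3)^2 \<le> (A1^2+c*B1^2)*(A2^2+c*B2^2)*(A3^2+c*B3^2)"
proof -
  have "(A1^2+c*B1^2)*(A2^2+c*B2^2)*(A3^2+c*B3^2) - ((A1*A2*A3)^2 + c^3 * (B1*B2*B3)^2)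
    = c * ((A1*A2*B3)^2 + (A1*B2*A3)^2 + (B1*A2*A3)^2) + c^2 * ((A1*B2*B3)^2 + (B1*A2*B3)^2 + (B1*B2*A3)^2)"
    by (simp add: algebra_simps power2_eq_square power3_eq_cube)
  also have "\<dots> \<ge> 0" using assms by simp
  finally show ?thesis by simp
qed

text \<open>Here \<open>\<delta>\<close> is the absolute value of the discriminant of the quadratic field, \<open>Fp\<close> and \<open>Fe\<close> are the
indices of twice the real part and of the imaginary part of a generator, and \<open>T, S, N\<close> are the elementary
symmetric functions of the imaginary part. As \<open>Fe\<close> cannot vanish, the first inequality leaves only \<open>\<delta> = 3\<close> and \<open>\<delta> = 4\<close>, and the
Eisenstein case \<open>\<delta> = 3\<close> fails because no admissible cubic has positive discriminant.\<close>

lemma disc_four_of_index_bounds: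
  fixes \<delta> m Fp Fe k T S N :: int
  assumes "\<delta> \<ge> 3" "m \<ge> 7" and N: "N^2 = 1" and k: "k = T*S - N"
    and i: "Fp^2 + \<delta>^3 * Fe^2 \<le> 64" and ii: "m^2 * Fp^2 + \<delta>^3 * k^2 \<le> 64"
    and Fe0: "Fe = 0 \<Longrightarrow> k^2 = 64" and Fp0: "Fp = 0 \<Longrightarrow> \<delta>^3 * k^2 = 64"
    and disc: "T^2*S^2 - 4*S^3 - 4*T^3*N + 18*T*S*N - 27*N^2 = m^2 * Fe^2"
  shows "\<delta> = 4 \<and> Fp = 0 \<and> k^2 = 1 \<and> Fe^2 = 1"
proof -
  have sq_ge: "x^2 \<ge> 1" if "x \<noteq> 0" for x :: int
    using that zero_less_power2[of x] by linarith
  have d27: "\<delta>^3 \<ge> 27" using power_mono[of 3 \<delta> 3] assms(1) by simp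
  \<comment> \<open>A rational imaginary part gives conjugates that are too far apart for \<open>ii\<close>.\<close>
  have "Fe \<noteq> 0"
  proof
    assume "Fe = 0"
    with Fe0 ii have "m^2 * Fp^2 + \<delta>^3 * 64 \<le> 64" by simp
    moreover have "m^2 * Fp^2 \<ge> 0" by simp
    ultimately show False using d27 by linarith
  qed
  then have Fe: "Fe^2 \<ge> 1" by (rule sq_ge)
  have "\<delta>^3 * 1 \<le> \<delta>^3 * Fe^2" using Fe assms(1) by (intro mult_left_mono) auto
  moreover have "Fp^2 \<ge> 0" by simp
  ultimately have "\<delta>^3 \<le> 64" using i by linarith
  then have "\<delta> \<le> 4" using power_mono[of 5 \<delta> 3] by (cases "\<delta> \<le> 4") auto
  then consider "\<delta> = 3" | "\<delta> = 4" using assms(1) by linarith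
  then show ?thesis
  proof cases
    case 1
    have "27 * x \<noteq> 64" for x :: int by presburger
    then have "Fp \<noteq> 0" using Fp0 1 by auto
    then have "m^2 * 1 \<le> m^2 * Fp^2" using sq_ge by (intro mult_left_mono) auto
    moreover have "m^2 \<ge> 49" using power_mono[of 7 m 2] assms(2) by simp
    ultimately have "27 * k^2 \<le> 15" using ii 1 by simp
    then have "k = 0" using sq_ge[of k] by (cases "k = 0") auto
    \<comment> \<open>For \<open>\<delta> = 3\<close> this leaves \<open>x\<^sup>3 \<plusminus> x\<^sup>2 \<plusminus> x \<plusminus> 1\<close> with \<open>T S = N\<close>, which has no positive
      discriminant.\<close>
    then have TS: "T * S = N" using k by simp
    have "N = 1 \<or> N = -1" using N by (simp add: power2_eq_1_iff)
    then have "(T = 1 \<or> T = -1) \<and> (S = 1 \<or> S = -1)" using TS by (auto simp: zmult_eq_1_iff zmult_eq_neg1_iff)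
    then have "m^2 * Fe^2 \<le> 0" using disc TS by auto
    moreover have "m^2 * Fe^2 > 0" using \<open>m^2 \<ge> 49\<close> Fe by (intro mult_pos_pos) auto
    ultimately show ?thesis by linarith
  next
    case 2
    then have "Fp^2 + 64 * Fe^2 \<le> 64" using i by simp
    moreover have "Fp^2 \<ge> 0" by simp
    ultimately have "Fe^2 = 1" "Fp^2 = 0" using Fe by linarith+
    then show ?thesis using Fp0 2 by simp
  qed
qed

text \<open>The arithmetic core, over the reals: \<open>p\<close> stands for twice the real part of a generator and \<open>e\<close> for
its imaginary part in units of \<open>\<surd>\<delta> / 2\<close>. The two product hypotheses bound the differences of conjugates
of the generator over the quadratic field, respectively of conjugates that restrict differently to it. The
conclusion is that the real part is rational and that \<open>e\<close> is, up to sign, a root of the cubic or a root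
plus 1.\<close>

lemma real_coordinates_of_generator:
  fixes x1 x2 x3 :: real and e p :: "real \<Rightarrow> real" and a y0 y1 y2 c0 c1 c2 \<delta> m :: int
  defines "e \<equiv> \<lambda>x::real. of_int y0 + of_int y1 * x + of_int y2 * x^2"
    and "p \<equiv> \<lambda>x::real. of_int c0 + of_int c1 * x + of_int c2 * x^2"
    and "m \<equiv> a^2+3*a+9"
  assumes rels: "x1+x2+x3 = of_int a" "x1*x2+x2*x3+x3*x1 = -(of_int a+3)" "x1*x2*x3 = 1"
    and indep: "\<And>x b0 b1. x \<in> {x1,x2,x3} \<Longrightarrow> of_int b0 + of_int b1 * x = 0 \<Longrightarrow> b0 = 0 \<and> b1 = 0"
    and \<delta>: "\<delta> \<ge> 3" and m: "m \<ge> 7"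
    and N: "(e x1 * e x2 * e x3)^2 = 1"
    and rel: "((p x1 - p x2)^2 + \<delta> * (e x1 - e x2)^2) * ((p x2 - p x3)^2 + \<delta> * (e x2 - e x3)^2) * ((p x3 - p x1)^2 + \<delta> * (e x3 - e x1)^2) \<le> 64 * m^2"
    and abs: "((p x1 - p x2)^2 + \<delta> * (e x1 + e x2)^2) * ((p x2 - p x3)^2 + \<delta> * (e x2 + e x3)^2) * ((p x3 - p x1)^2 + \<delta> * (e x3 + e x1)^2) = 64"
  shows "\<delta> = 4 \<and> c1 = 0 \<and> c2 = 0 \<and> a \<in> {-3,-2,-1,0} \<and>
    (\<exists>\<epsilon>\<in>{1,-1}. \<exists>h\<in>{0,1}. (\<epsilon> * e x1 - h)^3 = of_int a * (\<epsilon> * e x1 - h)^2 + of_int (a+3) * (\<epsilon> * e x1 - h) + 1)"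
proof -
  define IF :: "int \<Rightarrow> int \<Rightarrow> int" where "IF X Y = X^3 - a*X^2*Y - (a+3)*X*Y^2 - Y^3" for X Y
  define Fe Fp where "Fe = IF (y1 + a*y2) y2" and "Fp = IF (c1 + a*c2) c2"
  define D where "D = (x1-x2)*(x2-x3)*(x3-x1)"
  have D: "D^2 = of_int (m^2)" unfolding D_def simplest_cubic_discriminant[OF rels] m_def by simp
  have De: "(e x1 - e x2) * (e x2 - e x3) * (e x3 - e x1) = D * of_int Fe"
    unfolding e_def D_def Fe_def IF_def index_form[OF rels] by simp
  have Dp: "(p x1 - p x2) * (p x2 - p x3) * (p x3 - p x1) = D * of_int Fp"
    unfolding p_def D_def Fp_def IF_def index_form[OF rels] by simp
  have IF0: "X = 0 \<and> Y = 0" if "IF X Y = 0" for X Y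
  proof -
    have "of_int (IF X Y) = (of_int X + of_int (-Y) * x1 + 0 * x1^2) * (of_int X + of_int (-Y) * x2 + 0 * x2^2) * (of_int X + of_int (-Y) * x3 + 0 * x3^2)"
      unfolding norm_form[OF rels] IF_def by (simp add: algebra_simps)
    then have "of_int X + of_int (-Y) * x1 = 0 \<or> of_int X + of_int (-Y) * x2 = 0 \<or> of_int X + of_int (-Y) * x3 = 0"
      using that by simp
    then show ?thesis using indep[of _ X "-Y"] by auto
  qed
  \<comment> \<open>\<open>x\<^sup>3 - T x\<^sup>2 + S x - N\<close> is the characteristic polynomial of \<open>e\<close>.\<close>
  define T where "T = 3*y0+y1*a+y2*(a^2+2*a+6)"
  define S where "S = 3*y0^2+2*y0*y1*a+2*y0*y2*(a^2+2*a+6) - y1^2*(a+3) - y1*y2*(a^2+3*a+3)+y2^2*(a^2+4*a+9)"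
  define N where "N = y0^3 + y0^2*y1*a + y0^2*y2*(a^2+2*a+6) - y0*y1^2*(a+3) - y0*y1*y2*(a^2+3*a+3)
     + y0*y2^2*(a^2+4*a+9) + y1^3 + y1^2*y2*a - y1*y2^2*(a+3) + y2^3"
  define Q where "Q = (y1+a*y2)^2 + (y1+a*y2)*y2+y2^2"
  have T: "e x1 + e x2 + e x3 = of_int T"
    unfolding e_def trace_form[OF rels(1,2)] T_def by simp
  have S: "e x1 * e x2 + e x2 * e x3 + e x3 * e x1 = of_int S"
    unfolding e_def second_symmetric_form[OF rels] S_def by simp
  have Nr: "e x1 * e x2 * e x3 = of_int N"
    unfolding e_def norm_form[OF rels] N_def by simp
  have "of_int (N^2) = (of_int 1 :: real)" using N unfolding Nr by simp
  then have N1: "N^2 = 1" unfolding of_int_eq_iff .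
  have "of_int (T^2 - 3*S) = (of_int (m * Q) :: real)"
    using hessian_form[OF rels, of "of_int y0" "of_int y1" "of_int y2"] T S unfolding Q_def m_def e_def by simp
  then have Q: "T^2 - 3*S = m * Q" unfolding of_int_eq_iff .
  have "of_int (T^2*S^2 - 4*S^3 - 4*T^3*N + 18*T*S*N - 27*N^2) = (of_int (m^2 * Fe^2) :: real)"
    using cubic_discriminant[of "e x1" "e x2" "e x3"] unfolding De T S Nr by (simp add: power_mult_distrib D)
  then have disc: "T^2*S^2 - 4*S^3 - 4*T^3*N + 18*T*S*N - 27*N^2 = m^2 * Fe^2" unfolding of_int_eq_iff .
  \<comment> \<open>\<open>k\<close> is the value of that polynomial at \<open>T\<close>, that is, the norm of the sum of two conjugates.\<close>
  define k where "k = T*S - N"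
  have "(e x1 + e x2) * (e x2 + e x3) * (e x3 + e x1) = (e x1 + e x2 + e x3) * (e x1 * e x2 + e x2 * e x3 + e x3 * e x1) - e x1 * e x2 * e x3"
    by (simp add: algebra_simps power2_eq_square)
  then have k: "(e x1 + e x2) * (e x2 + e x3) * (e x3 + e x1) = of_int k"
    unfolding T S Nr k_def by simp
  have "(D * of_int Fp)^2 + of_int \<delta>^3 * (D * of_int Fe)^2 \<le> 64 * of_int (m^2)"
    unfolding De[symmetric] Dp[symmetric] using rel \<delta> by (intro order.trans[OF prod_sum_squares_ge]) simp_all
  then have "of_int (m^2 * (Fp^2 + \<delta>^3 * Fe^2)) \<le> (of_int (m^2 * 64) :: real)"
    by (simp add: power_mult_distrib D algebra_simps)
  then have "m^2 * (Fp^2 + \<delta>^3 * Fe^2) \<le> m^2 * 64" unfolding of_int_le_iff .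
  then have i: "Fp^2 + \<delta>^3 * Fe^2 \<le> 64" using m by (simp add: mult_le_cancel_left_pos)
  have "(D * of_int Fp)^2 + of_int \<delta>^3 * (of_int k)^2 \<le> 64"
    unfolding k[symmetric] Dp[symmetric] using abs \<delta> by (intro order.trans[OF prod_sum_squares_ge]) simp_all
  then have "of_int (m^2 * Fp^2 + \<delta>^3 * k^2) \<le> (of_int 64 :: real)"
    by (simp add: power_mult_distrib D algebra_simps)
  then have ii: "m^2 * Fp^2 + \<delta>^3 * k^2 \<le> 64" unfolding of_int_le_iff .
  have Fe0: "k^2 = 64" if "Fe = 0"
  proof -
    have "y1 + a*y2 = 0 \<and> y2 = 0" using that unfolding Fe_def by (rule IF0)
    then have "y1 = 0 \<and> y2 = 0" by auto
    then have "T = 3*y0" "S = 3*y0^2" "N = y0^3" unfolding T_def S_def N_def by simp_all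
    then have "k = 8 * N" unfolding k_def by (simp add: power2_eq_square power3_eq_cube)
    then show ?thesis by (simp add: power_mult_distrib N1)
  qed
  have c0: "c1 = 0 \<and> c2 = 0" if "Fp = 0"
  proof -
    have "c1 + a*c2 = 0 \<and> c2 = 0" using that unfolding Fp_def by (rule IF0)
    then show ?thesis by auto
  qed
  have Fp0: "\<delta>^3 * k^2 = 64" if "Fp = 0"
  proof -
    have "p x = of_int c0" for x using c0[OF that] by (simp add: p_def)
    then have "of_int \<delta>^3 * ((e x1 + e x2) * (e x2 + e x3) * (e x3 + e x1))^2 = 64"
    proof -
      have "d^3 * (E1*E2*E3)^2 = (d*E1^2)*(d*E2^2)*(d*E3^2)" for d E1 E2 E3 :: real
        by (simp add: power_mult_distrib power3_eq_cube mult_ac)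
      then show ?thesis using abs \<open>\<And>x. p x = of_int c0\<close> by simp
    qed
    then have "of_int (\<delta>^3 * k^2) = (of_int 64 :: real)" unfolding k by simp
    then show ?thesis unfolding of_int_eq_iff .
  qed
  from disc_four_of_index_bounds[OF \<delta> m N1 k_def i ii Fe0 Fp0 disc]
  have r: "\<delta> = 4" "Fp = 0" "k^2 = 1" "Fe^2 = 1" by blast+
  have Npm: "N = 1 \<or> N = -1" using N1 by (simp add: power2_eq_1_iff)
  have NT: "N*T \<in> {-3,-2,-1,0} \<and> S = -(N*T+3) \<and> m = (N*T)^2+3*(N*T)+9"
  proof (rule index_one_unit_charpoly[of _ _ m Q])
    show "(N*T*S-1)^2 = 1" using r(3) Npm unfolding k_def by (elim disjE) (simp_all add: power2_eq_square algebra_simps)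
    show "(N*T)^2*S^2 - 4*S^3 - 4*(N*T)^3 + 18*(N*T)*S - 27 = m^2"
      using disc r(4) Npm by (elim disjE) (simp_all add: power_mult_distrib)
    show "(N*T)^2 - 3*S = m*Q" using Q N1 by (simp add: power_mult_distrib)
  qed (rule m)
  \<comment> \<open>Up to the sign \<open>N\<close>, \<open>e\<close> is therefore a root of the simplest cubic with parameter \<open>N T\<close>, whose
    discriminant agrees with that for \<open>a\<close>.\<close>
  then have "(a - N*T) * (a + N*T + 3) = 0" unfolding m_def by (simp add: algebra_simps power2_eq_square)
  then have aT: "a = N*T \<or> a = -3 - N*T" by auto
  have a: "a \<in> {-3,-2,-1,0}" using NT aT by auto
  define u where "u = of_int N * e x1"
  have cub: "e x1^3 = of_int T * e x1^2 - of_int S * e x1 + of_int N"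
    unfolding T[symmetric] S[symmetric] Nr[symmetric] by (simp add: algebra_simps power2_eq_square power3_eq_cube)
  have N1r: "(of_int N::real)^2 = 1" using N unfolding Nr .
  have "u^3 = of_int N^2 * (of_int N * e x1^3)" unfolding u_def by (simp add: power_mult_distrib power2_eq_square power3_eq_cube)
  also have "\<dots> = of_int (N*T) * (of_int N^2 * e x1^2) - of_int S * u + of_int N^2" 
    unfolding cub N1r u_def using N1r by (simp add: algebra_simps power2_eq_square)
  also have "\<dots> = of_int (N*T) * u^2 + of_int (N*T+3) * u + 1"
  proof -
    have "S = -(N*T+3)" using NT by simp
    then have Sr: "of_int S = - (of_int (N*T+3) :: real)" by (metis of_int_minus)
    show ?thesis unfolding Sr by (simp add: u_def power_mult_distrib N1r algebra_simps)
  qed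
  finally have u: "u^3 = of_int (N*T) * u^2 + of_int (N*T+3) * u + 1" .
  show ?thesis
  proof (cases "a = N*T")
    case True
    then have "(of_int N * e x1 - 0)^3 = of_int a * (of_int N * e x1 - 0)^2 + of_int (a+3) * (of_int N * e x1 - 0) + 1"
      using u unfolding u_def by simp
    moreover have "real_of_int N \<in> {1,-1}" using Npm by auto
    ultimately show ?thesis using r(1) c0[OF r(2)] a by blast
  next
    case False
    then have NT_a: "N*T = -3 - a" using aT by simp
    \<comment> \<open>The substitution \<open>x \<mapsto> -1 - x\<close> exchanges the parameters \<open>a\<close> and \<open>-3 - a\<close>.\<close>
    let ?v = "of_int (-N) * e x1 - 1"
    have v: "?v = - u - 1" by (simp add: u_def)
    have "?v^3 = of_int a * ?v^2 + of_int (a+3) * ?v + 1"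
      using u unfolding v NT_a by (simp add: algebra_simps power2_eq_square power3_eq_cube)
    moreover have "real_of_int (-N) \<in> {1,-1}" using Npm by auto
    ultimately show ?thesis using r(1) c0[OF r(2)] a by blast
  qed
qed

section \<open>Conjugates over an imaginary quadratic ring\<close>

text \<open>The generator \<open>w\<close> of the quadratic ring is described by its trace \<open>t\<close> and norm \<open>n\<close>, so that the two
cases in the definition of \<open>quad_omega\<close> are treated at once.\<close>

locale quad_cubic =
  fixes w :: complex and t n a :: int
  assumes w_square: "w^2 = of_int t * w - of_int n"
    and Im_w_pos: "Im w > 0"
begin

definition \<delta> :: int where "\<delta> = 4*n - t^2"

lemma Re_w: "Re w = of_int t / 2" and Im_w_sq: "(2 * Im w)^2 = of_int \<delta>"
proof -
  have "Im (w^2) = Im (of_int t * w - of_int n)" and e: "Re (w^2) = Re (of_int t * w - of_int n)"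
    using w_square by simp_all
  then have "(2 * Re w - of_int t) * Im w = 0" by (simp add: power2_eq_square algebra_simps)
  then show r: "Re w = of_int t / 2" using Im_w_pos by simp
  from e show "(2 * Im w)^2 = of_int \<delta>"
    unfolding \<delta>_def by (simp add: r power2_eq_square field_simps)
qed

lemma cnj_w: "cnj w = of_int t - w"
  by (simp add: complex_eq_iff Re_w)

definition quad_ints :: "complex set" where "quad_ints = {of_int x + of_int y * w | x y. True}"

lemma quad_ints_I: "z = of_int x + of_int y * w \<Longrightarrow> z \<in> quad_ints"
  unfolding quad_ints_def by blast

lemma quad_ints_E: assumes "z \<in> quad_ints" obtains x y where "z = of_int x + of_int y * w"
  using assms unfolding quad_ints_def by blast

lemma quad_ints_of_int [simp]: "of_int k \<in> quad_ints" by (rule quad_ints_I[of _ k 0]) simp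

lemma quad_ints_0 [simp]: "0 \<in> quad_ints" and quad_ints_1 [simp]: "1 \<in> quad_ints" and quad_ints_numeral [simp]: "numeral k \<in> quad_ints"
  using quad_ints_of_int[of 0] quad_ints_of_int[of 1] quad_ints_of_int[of "numeral k"] by simp_all

lemma quad_ints_w [simp]: "w \<in> quad_ints" by (rule quad_ints_I[of _ 0 1]) simp

lemma quad_ints_add [simp]: "x \<in> quad_ints \<Longrightarrow> y \<in> quad_ints \<Longrightarrow> x + y \<in> quad_ints"
  by (elim quad_ints_E, rule quad_ints_I[of _ "_ + _" "_ + _"]) (simp add: algebra_simps)

lemma quad_ints_mult [simp]:
  assumes "x \<in> quad_ints" "y \<in> quad_ints" shows "x * y \<in> quad_ints"
proof -
  obtain b c p q where e: "x = of_int b + of_int c * w" "y = of_int p + of_int q * w"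
    using assms by (elim quad_ints_E)
  have "x * y = of_int (b*p) + of_int (b*q+c*p) * w + of_int (c*q) * w^2"
    by (simp add: e algebra_simps power2_eq_square)
  then show ?thesis
    by (intro quad_ints_I[of _ "b*p - c*q*n" "b*q+c*p+c*q*t"]) (simp add: w_square algebra_simps)
qed

lemma quad_ints_uminus [simp]: "x \<in> quad_ints \<Longrightarrow> - x \<in> quad_ints"
  using quad_ints_mult[OF quad_ints_of_int[of "-1"], of x] by simp

lemma quad_ints_diff [simp]: "x \<in> quad_ints \<Longrightarrow> y \<in> quad_ints \<Longrightarrow> x - y \<in> quad_ints"
  using quad_ints_add[of x "-y"] by simp

lemma quad_ints_power [simp]: "x \<in> quad_ints \<Longrightarrow> x ^ k \<in> quad_ints"
  by (induction k) simp_all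

lemma quad_ints_cnj [simp]: "x \<in> quad_ints \<Longrightarrow> cnj x \<in> quad_ints"
  by (elim quad_ints_E) (simp add: cnj_w)

lemma quad_ints_norm_int:
  assumes "z \<in> quad_ints" shows "\<exists>k::int. (cmod z)^2 = of_int k"
proof -
  obtain x y where z: "z = of_int x + of_int y * w" using assms by (rule quad_ints_E)
  have "(cmod z)^2 = (of_int x + of_int y * Re w)^2 + (of_int y)^2 * (2 * Im w)^2 / 4"
    unfolding cmod_power2 z by (simp add: power2_eq_square)
  also have "\<dots> = of_int (x^2 + x*y*t + y^2*n)"
    unfolding Im_w_sq unfolding \<delta>_def Re_w by (simp add: power2_eq_square field_simps)
  finally show ?thesis by blast
qed

definition roots :: "complex set" where
  "roots = {r. r^3 = of_int a * r^2 + of_int (a+3) * r + 1}"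

text \<open>On the roots this polynomial agrees with the map \<open>r \<mapsto> -1 / (1 + r)\<close>, a generator of the Galois
group; the polynomial form keeps the coefficients integral.\<close>

definition \<sigma> :: "complex \<Rightarrow> complex" where "\<sigma> r = r^2 - of_int (a+1) * r - 2"

lemma roots_D: "r \<in> roots \<Longrightarrow> r^3 = of_int a * r^2 + of_int (a+3) * r + 1"
  by (simp add: roots_def)

lemma sigma_sigma: assumes "r \<in> roots" shows "\<sigma> (\<sigma> r) = of_int a * r + of_int (a+2) - r^2"
  using roots_D[OF assms] unfolding \<sigma>_def of_int_add of_int_1 of_int_numeral by algebra

lemma sum_conj: "r \<in> roots \<Longrightarrow> r + \<sigma> r + \<sigma> (\<sigma> r) = of_int a"
  unfolding sigma_sigma unfolding \<sigma>_def by (simp add: algebra_simps)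

lemma sum2_conj: assumes "r \<in> roots" shows "r * \<sigma> r + \<sigma> r * \<sigma> (\<sigma> r) + \<sigma> (\<sigma> r) * r = - (of_int a + 3)"
  using roots_D[OF assms] unfolding sigma_sigma[OF assms] unfolding \<sigma>_def of_int_add of_int_1 of_int_numeral by algebra

lemma prod_conj: assumes "r \<in> roots" shows "r * \<sigma> r * \<sigma> (\<sigma> r) = 1"
  using roots_D[OF assms] unfolding sigma_sigma[OF assms] unfolding \<sigma>_def of_int_add of_int_1 of_int_numeral by algebra

lemmas conj_rels = sum_conj sum2_conj prod_conj

lemma sigma_in_roots: assumes "r \<in> roots" shows "\<sigma> r \<in> roots"
  using roots_D[OF assms] unfolding roots_def \<sigma>_def of_int_add of_int_1 of_int_numeral mem_Collect_eq by algebra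

lemma sigma_cubed: assumes "r \<in> roots" shows "\<sigma> (\<sigma> (\<sigma> r)) = r"
  using sigma_sigma[OF sigma_in_roots[OF assms]] roots_D[OF assms] unfolding \<sigma>_def of_int_add of_int_1 of_int_numeral by algebra

lemma roots_factor: assumes "r \<in> roots" "x \<in> roots" shows "x = r \<or> x = \<sigma> r \<or> x = \<sigma> (\<sigma> r)"
proof -
  have "(x - r) * (x - \<sigma> r) * (x - \<sigma> (\<sigma> r)) =
    x^3 - (r + \<sigma> r + \<sigma> (\<sigma> r)) * x^2 + (r * \<sigma> r + \<sigma> r * \<sigma> (\<sigma> r) + \<sigma> (\<sigma> r) * r) * x - r * \<sigma> r * \<sigma> (\<sigma> r)"
    by (simp add: algebra_simps power2_eq_square power3_eq_cube)
  also have "\<dots> = 0" unfolding conj_rels[OF assms(1)] using roots_D[OF assms(2)] by (simp add: algebra_simps)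
  finally show ?thesis by auto
qed

lemma roots_real: assumes "r \<in> roots" shows "Im r = 0"
proof -
  let ?p = "[:- 1, - of_int (a + 3), - of_int a, 1:] :: real poly"
  \<comment> \<open>The cubic takes the values 1 at -1 and -1 at 0; one real root suffices, since \<open>\<sigma>\<close> produces the
    other two from it by real operations.\<close>
  have "\<exists>x. -1 < x \<and> x < 0 \<and> poly ?p x = 0"
    by (rule poly_IVT_neg) simp_all
  then obtain x where "poly ?p x = 0" by blast
  then have "x^3 = of_int a * x^2 + of_int (a+3) * x + 1"
    by (simp add: power2_eq_square power3_eq_cube algebra_simps)
  then have "complex_of_real (x^3) = complex_of_real (of_int a * x^2 + of_int (a+3) * x + 1)" by simp
  then have "complex_of_real x \<in> roots" unfolding roots_def by simp
  from roots_factor[OF this assms] show ?thesis unfolding \<sigma>_def by auto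
qed

lemma roots_of_real: "r \<in> roots \<Longrightarrow> r = of_real (Re r)"
  by (simp add: complex_eq_iff roots_real)

lemma cnj_roots: "r \<in> roots \<Longrightarrow> cnj r = r"
  by (simp add: complex_eq_iff roots_real)

definition m :: int where "m = a^2+3*a+9"

lemma m_ge: "m \<ge> 7"
proof -
  have "4 * m = (2*a+3)^2 + 27" by (simp add: m_def power2_eq_square algebra_simps)
  then have "4 * m \<ge> 27" by simp
  then show ?thesis by linarith
qed

lemma disc_conj: assumes "r \<in> roots" shows "((r - \<sigma> r) * (\<sigma> r - \<sigma> (\<sigma> r)) * (\<sigma> (\<sigma> r) - r))^2 = of_int (m^2)"
  unfolding simplest_cubic_discriminant[OF conj_rels[OF assms]] m_def by simp

lemma sigma_neq: assumes "r \<in> roots" shows "\<sigma> r \<noteq> r"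
  using disc_conj[OF assms] m_ge by auto

text \<open>An element of \<open>\<int>[w, \<alpha>]\<close> together with its conjugates over the quadratic field, as a function of the
chosen root. Field automorphisms become composition with \<open>\<sigma>\<close>, and an identity of families is an identity
that holds for all conjugates.\<close>

definition conj_family :: "(complex \<Rightarrow> complex) \<Rightarrow> bool" where
  "conj_family z \<longleftrightarrow> (\<exists>u0\<in>quad_ints. \<exists>u1\<in>quad_ints. \<exists>u2\<in>quad_ints. \<forall>r\<in>roots. z r = u0 + u1 * r + u2 * r^2)"

lemma conj_familyI: "u0 \<in> quad_ints \<Longrightarrow> u1 \<in> quad_ints \<Longrightarrow> u2 \<in> quad_ints \<Longrightarrow> (\<And>r. r \<in> roots \<Longrightarrow> z r = u0 + u1 * r + u2 * r^2) \<Longrightarrow> conj_family z"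
  unfolding conj_family_def by blast

lemma conj_familyE:
  assumes "conj_family z"
  obtains u0 u1 u2 where "u0 \<in> quad_ints" "u1 \<in> quad_ints" "u2 \<in> quad_ints" "\<And>r. r \<in> roots \<Longrightarrow> z r = u0 + u1 * r + u2 * r^2"
  using assms unfolding conj_family_def by blast

lemma conj_family_const [intro]: "c \<in> quad_ints \<Longrightarrow> conj_family (\<lambda>r. c)" by (rule conj_familyI[of c 0 0]) simp_all

lemma conj_family_id [intro]: "conj_family (\<lambda>r. r)" by (rule conj_familyI[of 0 1 0]) simp_all

lemma conj_family_add [intro]: assumes "conj_family y" "conj_family z" shows "conj_family (\<lambda>r. y r + z r)"
proof -
  obtain u0 u1 u2 where u: "u0 \<in> quad_ints" "u1 \<in> quad_ints" "u2 \<in> quad_ints" "\<And>r. r \<in> roots \<Longrightarrow> y r = u0 + u1 * r + u2 * r^2" using assms(1) by (rule conj_familyE) blast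
  obtain v0 v1 v2 where v: "v0 \<in> quad_ints" "v1 \<in> quad_ints" "v2 \<in> quad_ints" "\<And>r. r \<in> roots \<Longrightarrow> z r = v0 + v1 * r + v2 * r^2" using assms(2) by (rule conj_familyE) blast
  show ?thesis by (rule conj_familyI[of "u0+v0" "u1+v1" "u2+v2"]) (use u v in \<open>simp_all add: algebra_simps\<close>)
qed

lemma conj_family_mult [intro]: assumes "conj_family y" "conj_family z" shows "conj_family (\<lambda>r. y r * z r)"
proof -
  obtain u0 u1 u2 where u: "u0 \<in> quad_ints" "u1 \<in> quad_ints" "u2 \<in> quad_ints" "\<And>r. r \<in> roots \<Longrightarrow> y r = u0 + u1 * r + u2 * r^2" using assms(1) by (rule conj_familyE) blast
  obtain v0 v1 v2 where v: "v0 \<in> quad_ints" "v1 \<in> quad_ints" "v2 \<in> quad_ints" "\<And>r. r \<in> roots \<Longrightarrow> z r = v0 + v1 * r + v2 * r^2" using assms(2) by (rule conj_familyE) blast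
  define c2 c3 c4 where c: "c2 = u0*v2+u1*v1+u2*v0" "c3 = u1*v2+u2*v1" "c4 = u2*v2"
  show ?thesis
  proof (rule conj_familyI[of "u0*v0 + c3 + c4*of_int a" "u0*v1+u1*v0 + c3*of_int (a+3) + c4*of_int (a*(a+3)+1)" "c2 + c3*of_int a + c4*of_int(a^2+a+3)"])
    fix r assume r: "r \<in> roots"
    have r4: "r^4 = of_int a * r^3 + of_int (a+3) * r^2 + r"
      using arg_cong[OF roots_D[OF r], of "\<lambda>x. r * x"] by (simp add: algebra_simps power2_eq_square power3_eq_cube power4_eq_xxxx)
    have "y r * z r = u0*v0 + (u0*v1+u1*v0)*r + c2*r^2 + c3*r^3 + c4*r^4"
      unfolding u(4)[OF r] v(4)[OF r] c by (simp add: algebra_simps power2_eq_square power3_eq_cube power4_eq_xxxx)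
    also have "\<dots> = u0*v0 + c3 + c4*of_int a + (u0*v1+u1*v0 + c3*of_int (a+3) + c4*of_int (a*(a+3)+1)) * r + (c2 + c3*of_int a + c4*of_int(a^2+a+3)) * r^2"
      unfolding r4 roots_D[OF r] by (simp add: algebra_simps power2_eq_square)
    finally show "y r * z r = \<dots>" .
  qed (use u v in \<open>simp_all add: c\<close>)
qed

lemma conj_family_diff [intro]: assumes "conj_family y" "conj_family z" shows "conj_family (\<lambda>r. y r - z r)"
  using conj_family_add[OF assms(1) conj_family_mult[OF conj_family_const[of "-1"] assms(2)]] by simp

lemma conj_family_sigma: "conj_family \<sigma>"
  by (rule conj_familyI[of "-2" "- of_int (a+1)" 1]) (simp_all add: \<sigma>_def del: of_int_add)

lemma conj_family_shift [intro]: assumes "conj_family z" shows "conj_family (\<lambda>r. z (\<sigma> r))"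
proof -
  obtain u0 u1 u2 where u: "u0 \<in> quad_ints" "u1 \<in> quad_ints" "u2 \<in> quad_ints" "\<And>r. r \<in> roots \<Longrightarrow> z r = u0 + u1 * r + u2 * r^2" using assms(1) by (rule conj_familyE) blast
  have "conj_family (\<lambda>r. u0 + u1 * \<sigma> r + u2 * (\<sigma> r * \<sigma> r))" by (intro conj_family_add conj_family_mult conj_family_const conj_family_sigma u)
  then show ?thesis using u(4) sigma_in_roots unfolding conj_family_def by (simp add: power2_eq_square)
qed

text \<open>Complex conjugation acts on the coefficients only, as the roots are real.\<close>

lemma conj_family_cnj [intro]: assumes "conj_family z" shows "conj_family (\<lambda>r. cnj (z r))"
proof -
  obtain u0 u1 u2 where u: "u0 \<in> quad_ints" "u1 \<in> quad_ints" "u2 \<in> quad_ints" "\<And>r. r \<in> roots \<Longrightarrow> z r = u0 + u1 * r + u2 * r^2" using assms(1) by (rule conj_familyE) blast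
  show ?thesis by (rule conj_familyI[of "cnj u0" "cnj u1" "cnj u2"]) (use u in \<open>simp_all add: cnj_roots\<close>)
qed

definition conj_norm :: "(complex \<Rightarrow> complex) \<Rightarrow> complex \<Rightarrow> complex" where
  "conj_norm z r = z r * z (\<sigma> r) * z (\<sigma> (\<sigma> r))"

lemma conj_norm_in_quad_ints: assumes "conj_family z" "r \<in> roots" shows "conj_norm z r \<in> quad_ints"
proof -
  obtain u0 u1 u2 where u: "u0 \<in> quad_ints" "u1 \<in> quad_ints" "u2 \<in> quad_ints" "\<And>r. r \<in> roots \<Longrightarrow> z r = u0 + u1 * r + u2 * r^2" using assms(1) by (rule conj_familyE) blast
  show ?thesis
    unfolding conj_norm_def u(4)[OF assms(2)] u(4)[OF sigma_in_roots[OF assms(2)]] u(4)[OF sigma_in_roots[OF sigma_in_roots[OF assms(2)]]]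
      norm_form[OF conj_rels[OF assms(2)]] by (simp add: u)
qed

text \<open>The absolute value of a relative norm is at least 1, because its square is a positive integer. This
is how a product equal to 1 forces each of its factors to be a unit.\<close>

lemma cmod_conj_norm_ge_1:
  assumes "conj_family z" "r \<in> roots" "conj_norm z r \<noteq> 0" shows "cmod (conj_norm z r) \<ge> 1"
proof -
  obtain k :: int where k: "(cmod (conj_norm z r))^2 = of_int k" using quad_ints_norm_int[OF conj_norm_in_quad_ints[OF assms(1,2)]] by blast
  have "(cmod (conj_norm z r))^2 > 0" using assms(3) by simp
  then have "k \<ge> 1" unfolding k by simp
  then have "(cmod (conj_norm z r))^2 \<ge> 1^2" unfolding k by simp
  then show ?thesis by (rule power2_le_imp_le) simp
qed

lemma roots_independent:
  fixes x :: real
  assumes "of_real x \<in> roots" "of_int c0 + of_int c1 * x + of_int c2 * x^2 = 0"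
  shows "c0 = 0 \<and> c1 = 0 \<and> c2 = 0"
proof -
  let ?r = "complex_of_real x"
  have "of_int c0 + of_int c1 * ?r + of_int c2 * ?r^2 = 0" using arg_cong[OF assms(2), of complex_of_real] by simp
  from norm_form[OF conj_rels[OF assms(1)], of "of_int c0" "of_int c1" "of_int c2", unfolded this, symmetric]
  have "of_int (c0^3 + c0^2*c1*a + c0^2*c2*(a^2+2*a+6) - c0*c1^2*(a+3) - c0*c1*c2*(a^2+3*a+3)
     + c0*c2^2*(a^2+4*a+9) + c1^3 + c1^2*c2*a - c1*c2^2*(a+3) + c2^3) = (of_int 0 :: complex)" by simp
  then show ?thesis unfolding of_int_eq_iff by (rule norm_form_anisotropic)
qed

text \<open>The roots are real and \<open>w\<close> is not, so a relation splits into two integer relations, both of which are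
trivial. In other words, \<open>r \<mapsto> r'\<close> extends to a field isomorphism over the quadratic field.\<close>

lemma conj_family_zero:
  assumes "conj_family z" "r \<in> roots" "z r = 0" "r' \<in> roots" shows "z r' = 0"
proof -
  obtain u0 u1 u2 where u: "u0 \<in> quad_ints" "u1 \<in> quad_ints" "u2 \<in> quad_ints" "\<And>r. r \<in> roots \<Longrightarrow> z r = u0 + u1 * r + u2 * r^2" using assms(1) by (rule conj_familyE) blast
  obtain b0 b1 b2 c0 c1 c2 where bc: "u0 = of_int b0 + of_int c0 * w" "u1 = of_int b1 + of_int c1 * w" "u2 = of_int b2 + of_int c2 * w"
    using u(1-3) by (elim quad_ints_E)
  define x where "x = Re r"
  have r: "r = of_real x" unfolding x_def by (rule roots_of_real[OF assms(2)])
  have e: "(of_int b0 + of_int b1 * of_real x + of_int b2 * of_real x^2) + (of_int c0 + of_int c1 * of_real x + of_int c2 * of_real x^2) * w = 0"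
    using u(4)[OF assms(2), unfolded assms(3) bc] unfolding r by (simp add: algebra_simps)
  have re: "of_int b0 + of_int b1 * of_real x + of_int b2 * of_real x^2 = complex_of_real (of_int b0 + of_int b1 * x + of_int b2 * x^2)" for b0 b1 b2 by simp
  from arg_cong[OF e, of Im] have c: "of_int c0 + of_int c1 * x + of_int c2 * x^2 = 0"
    unfolding re using Im_w_pos by (simp del: of_real_add of_real_mult of_real_power)
  then have b: "of_int b0 + of_int b1 * x + of_int b2 * x^2 = 0" using e unfolding re c by (simp del: of_real_add of_real_mult of_real_power)
  show ?thesis using roots_independent[OF _ b] roots_independent[OF _ c] assms(2) u(4)[OF assms(4)] by (simp add: r bc)
qed

end

section \<open>Necessary conditions for a power integral basis\<close>

lemma poly_diff_synthetic_div:
  fixes p :: "'a::comm_ring_1 poly"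
  shows "poly p x - poly p c = (x - c) * poly (synthetic_div p c) x"
  using arg_cong[OF synthetic_div_correct'[of c p], of "\<lambda>q. poly q x"] by (simp add: algebra_simps)

lemma int_adjoin_self: "\<theta> \<in> int_adjoin \<theta>"
  unfolding int_adjoin_def by (intro CollectI exI[of _ "[:0,1:]"]) (simp add: map_poly_pCons)

context quad_cubic begin

text \<open>Families of polynomials with coefficients in \<open>\<int>[w, \<alpha>]\<close>. They are closed under division by
\<open>x - c\<close>, which keeps the quotients that occur below integral.\<close>

inductive poly_family :: "(complex \<Rightarrow> complex poly) \<Rightarrow> bool" where
  zero: "poly_family (\<lambda>r. 0)"
| pCons: "conj_family z \<Longrightarrow> poly_family P \<Longrightarrow> poly_family (\<lambda>r. pCons (z r) (P r))"

lemma poly_family_eval: "poly_family P \<Longrightarrow> conj_family c \<Longrightarrow> conj_family (\<lambda>r. poly (P r) (c r))"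
  by (induction rule: poly_family.induct) (auto intro!: conj_family_add conj_family_mult conj_family_const)

lemma poly_family_synthetic_div: "poly_family P \<Longrightarrow> conj_family c \<Longrightarrow> poly_family (\<lambda>r. synthetic_div (P r) (c r))"
  by (induction rule: poly_family.induct) (auto intro: poly_family.intros poly_family_eval)

lemma poly_family_of_int: "poly_family (\<lambda>r. map_poly of_int p)"
proof (induction p)
  case (pCons x p)
  have "conj_family (\<lambda>r. of_int x)" by (rule conj_family_const) simp
  from poly_family.pCons[OF this pCons.IH] show ?case using pCons.hyps by (simp add: map_poly_pCons)
qed (simp add: poly_family.zero)

lemma poly_family_diff_const:
  assumes "poly_family P" "c \<in> quad_ints" shows "poly_family (\<lambda>r. P r - [:c:])"
  using assms(1)
proof cases
  case zero
  have "poly_family (\<lambda>r. pCons (-c) 0)" by (intro poly_family.intros conj_family_const quad_ints_uminus assms)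
  then show ?thesis using zero by simp
next
  case (pCons z Q)
  have "poly_family (\<lambda>r. pCons (z r - c) (Q r))" by (intro poly_family.intros conj_family_diff conj_family_const pCons assms)
  then show ?thesis using pCons by simp
qed

lemma int_poly_cnj: "poly (map_poly of_int p) (cnj x) = cnj (poly (map_poly of_int p) x)"
  by (induction p) (simp_all add: map_poly_pCons)

lemma int_poly_transfer:
  assumes "conj_family \<theta>" "\<alpha> \<in> roots" "conj_family z" "z \<alpha> = poly (map_poly of_int p) (\<theta> \<alpha>)" "r \<in> roots"
  shows "poly (map_poly of_int p) (\<theta> r) = z r"
proof -
  have "conj_family (\<lambda>r. poly (map_poly of_int p) (\<theta> r) - z r)"
    by (intro conj_family_diff poly_family_eval poly_family_of_int assms)
  from conj_family_zero[OF this assms(2) _ assms(5)] assms(4) show ?thesis by simp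
qed

lemma conj_norm_mult: "conj_norm (\<lambda>r. y r * z r) r = conj_norm y r * conj_norm z r"
  by (simp add: conj_norm_def)

text \<open>If \<open>\<alpha>\<close> is an integer polynomial in \<open>\<theta>\<close>, so is each root in the corresponding conjugate of \<open>\<theta>\<close>, and a
difference of values of a polynomial is divisible by the difference of the arguments.\<close>

lemma conj_diff_dvd:
  assumes "conj_family \<theta>" "\<alpha> \<in> roots" "\<alpha> = poly (map_poly of_int p) (\<theta> \<alpha>)"
  shows "\<exists>k. conj_family k \<and> (\<forall>r\<in>roots. r - \<sigma> r = (\<theta> r - \<theta> (\<sigma> r)) * k r)"
proof -
  let ?P = "map_poly of_int p :: complex poly"
  have e: "poly ?P (\<theta> r) = r" if "r \<in> roots" for r
    using int_poly_transfer[OF assms(1,2) conj_family_id assms(3) that] .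
  have "conj_family (\<lambda>r. poly (synthetic_div ?P (\<theta> (\<sigma> r))) (\<theta> r))"
    by (intro poly_family_eval poly_family_synthetic_div poly_family_of_int conj_family_shift assms)
  moreover have "r - \<sigma> r = (\<theta> r - \<theta> (\<sigma> r)) * poly (synthetic_div ?P (\<theta> (\<sigma> r))) (\<theta> r)" if "r \<in> roots" for r
    using poly_diff_synthetic_div[of ?P "\<theta> r" "\<theta> (\<sigma> r)"] e[OF that] e[OF sigma_in_roots[OF that]] by simp
  ultimately show ?thesis by blast
qed

lemma rel_index_bound:
  assumes "conj_family \<theta>" "\<alpha> \<in> roots" "\<alpha> = poly (map_poly of_int p) (\<theta> \<alpha>)" "r \<in> roots"
  shows "(cmod (conj_norm (\<lambda>r. \<theta> r - \<theta> (\<sigma> r)) r))^2 \<le> of_int (m^2)"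
proof -
  obtain k where k: "conj_family k" "\<And>r. r \<in> roots \<Longrightarrow> r - \<sigma> r = (\<theta> r - \<theta> (\<sigma> r)) * k r"
    using conj_diff_dvd[OF assms(1-3)] by blast
  let ?d = "\<lambda>r. \<theta> r - \<theta> (\<sigma> r)"
  have "(r - \<sigma> r) * (\<sigma> r - \<sigma> (\<sigma> r)) * (\<sigma> (\<sigma> r) - r) = conj_norm ?d r * conj_norm k r"
    unfolding conj_norm_def using k(2)[OF assms(4)] k(2)[OF sigma_in_roots[OF assms(4)]] k(2)[OF sigma_in_roots[OF sigma_in_roots[OF assms(4)]]]
    by (simp add: sigma_cubed[OF assms(4)])
  then have e: "(conj_norm ?d r * conj_norm k r)^2 = of_int (m^2)" using disc_conj[OF assms(4)] by simp
  then have "conj_norm k r \<noteq> 0" using m_ge by auto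
  then have ge: "cmod (conj_norm k r) \<ge> 1" using cmod_conj_norm_ge_1[OF k(1) assms(4)] by simp
  have "(cmod (conj_norm ?d r))^2 * (cmod (conj_norm k r))^2 = of_int (m^2)"
    using arg_cong[OF e, of cmod] by (simp add: norm_mult norm_power power_mult_distrib)
  moreover have "(cmod (conj_norm ?d r))^2 * 1 \<le> (cmod (conj_norm ?d r))^2 * (cmod (conj_norm k r))^2"
    using ge by (intro mult_left_mono) auto
  ultimately show ?thesis by simp
qed

text \<open>The polynomial \<open>q - w\<close> vanishes at the three conjugates of \<open>\<theta>\<close> over the quadratic field, which are
distinct because \<open>\<alpha>\<close> is a polynomial in \<open>\<theta>\<close>. It is therefore divisible by the product of the three linear
factors, with an integral quotient \<open>k\<close>; the complex conjugate of \<open>\<theta>\<close> is then inserted.\<close>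

lemma conj_prod_unit:
  assumes "conj_family \<theta>" "\<alpha> \<in> roots" "\<alpha> = poly (map_poly of_int p) (\<theta> \<alpha>)" "w = poly (map_poly of_int q) (\<theta> \<alpha>)"
  shows "\<exists>k. conj_family k \<and> (\<forall>r\<in>roots. cnj w - w = (cnj (\<theta> r) - \<theta> r) * (cnj (\<theta> r) - \<theta> (\<sigma> r)) * (cnj (\<theta> r) - \<theta> (\<sigma> (\<sigma> r))) * k r)"
proof -
  obtain k0 where k0: "\<And>r. r \<in> roots \<Longrightarrow> r - \<sigma> r = (\<theta> r - \<theta> (\<sigma> r)) * k0 r"
    using conj_diff_dvd[OF assms(1-3)] by blast
  have neq: "\<theta> r \<noteq> \<theta> (\<sigma> r)" if "r \<in> roots" for r using k0[OF that] sigma_neq[OF that] by auto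
  let ?P = "map_poly of_int q :: complex poly"
  have e: "poly ?P (\<theta> r) = w" if "r \<in> roots" for r
    using int_poly_transfer[OF assms(1,2) conj_family_const[OF quad_ints_w] assms(4) that] .
  \<comment> \<open>Division of \<open>q - w\<close> by its three linear factors, one conjugate of \<open>\<theta>\<close> at a time.\<close>
  define P1 where "P1 r = synthetic_div (?P - [:w:]) (\<theta> r)" for r
  define P2 where "P2 r = synthetic_div (P1 r) (\<theta> (\<sigma> r))" for r
  define P3 where "P3 r = synthetic_div (P2 r) (\<theta> (\<sigma> (\<sigma> r)))" for r
  have "conj_family (\<lambda>r. poly (P3 r) (cnj (\<theta> r)))"
    unfolding P3_def P2_def P1_def
    by (intro poly_family_eval poly_family_synthetic_div poly_family_of_int poly_family_diff_const quad_ints_w conj_family_shift conj_family_cnj assms)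
  moreover have "cnj w - w = (cnj (\<theta> r) - \<theta> r) * (cnj (\<theta> r) - \<theta> (\<sigma> r)) * (cnj (\<theta> r) - \<theta> (\<sigma> (\<sigma> r))) * poly (P3 r) (cnj (\<theta> r))"
    if r: "r \<in> roots" for r
  proof -
    note sr = sigma_in_roots[OF r] sigma_in_roots[OF sigma_in_roots[OF r]]
    have 1: "poly ?P x - w = (x - \<theta> r) * poly (P1 r) x" for x
      using poly_diff_synthetic_div[of "?P - [:w:]" x "\<theta> r"] e[OF r] by (simp add: P1_def)
    have z1: "poly (P1 r) (\<theta> (\<sigma> r)) = 0" using 1[of "\<theta> (\<sigma> r)"] e[OF sr(1)] neq[OF r] by simp
    have z2: "poly (P1 r) (\<theta> (\<sigma> (\<sigma> r))) = 0" using 1[of "\<theta> (\<sigma> (\<sigma> r))"] e[OF sr(2)] neq[OF sr(2)] by (simp add: sigma_cubed[OF r])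
    have 2: "poly (P1 r) x = (x - \<theta> (\<sigma> r)) * poly (P2 r) x" for x
      using poly_diff_synthetic_div[of "P1 r" x "\<theta> (\<sigma> r)"] z1 by (simp add: P2_def)
    have z3: "poly (P2 r) (\<theta> (\<sigma> (\<sigma> r))) = 0" using 2[of "\<theta> (\<sigma> (\<sigma> r))"] z2 neq[OF sr(1)] by simp
    have 3: "poly (P2 r) x = (x - \<theta> (\<sigma> (\<sigma> r))) * poly (P3 r) x" for x
      using poly_diff_synthetic_div[of "P2 r" x "\<theta> (\<sigma> (\<sigma> r))"] z3 by (simp add: P3_def)
    \<comment> \<open>\<open>q\<close> has integer coefficients, so it maps \<open>cnj (\<theta> r)\<close> to \<open>cnj w\<close>.\<close>
    have "cnj w - w = poly ?P (cnj (\<theta> r)) - w" unfolding int_poly_cnj e[OF r] ..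
    then show ?thesis unfolding 1 2 3 by (simp add: mult_ac)
  qed
  ultimately show ?thesis by blast
qed

text \<open>Four relative norms of absolute value at least 1 have product 1. The argument starts from
\<open>conj_prod_unit\<close> and not from divisors of single differences, because \<open>cnj w - w\<close> and \<open>m\<close> may have a
common prime factor, and a number that divides both need not be a unit.\<close>

lemma unit_norms:
  assumes "conj_family \<theta>" "conj_family \<eta>" "\<And>r. r \<in> roots \<Longrightarrow> \<theta> r - cnj (\<theta> r) = (w - cnj w) * \<eta> r"
    and "\<alpha> \<in> roots" "\<alpha> = poly (map_poly of_int p) (\<theta> \<alpha>)" "w = poly (map_poly of_int q) (\<theta> \<alpha>)" "r \<in> roots"
  shows "cmod (conj_norm \<eta> r) = 1" "cmod (conj_norm (\<lambda>r. cnj (\<theta> r) - \<theta> (\<sigma> r)) r) = 1"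
proof -
  obtain k where k: "conj_family k" "\<And>r. r \<in> roots \<Longrightarrow> cnj w - w = (cnj (\<theta> r) - \<theta> r) * (cnj (\<theta> r) - \<theta> (\<sigma> r)) * (cnj (\<theta> r) - \<theta> (\<sigma> (\<sigma> r))) * k r"
    using conj_prod_unit[OF assms(1,4-6)] by blast
  define A where "A r = cnj (\<theta> r) - \<theta> (\<sigma> r)" for r
  define B where "B r = cnj (\<theta> r) - \<theta> (\<sigma> (\<sigma> r))" for r
  have fA: "conj_family A" and fB: "conj_family B" unfolding A_def B_def
    by (intro conj_family_diff conj_family_cnj conj_family_shift[of "\<lambda>r. \<theta> (\<sigma> r)"] conj_family_shift[of \<theta>] assms(1))+
  \<comment> \<open>Of the three factors in \<open>conj_prod_unit\<close>, the one that pairs \<open>\<theta> r\<close> with its own complex conjugate contributes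
    exactly \<open>cnj w - w\<close>, up to \<open>\<eta> r\<close>; cancelling it leaves a factorisation of 1.\<close>
  have one: "\<eta> r * (A r * (B r * k r)) = 1" if "r \<in> roots" for r
  proof -
    have "cnj w - w = (cnj w - w) * (\<eta> r * (A r * (B r * k r)))"
    proof -
      have d: "cnj (\<theta> r) - \<theta> r = (cnj w - w) * \<eta> r"
        using arg_cong[OF assms(3)[OF that], of uminus] by (simp add: left_diff_distrib)
      show ?thesis using k(2)[OF that] unfolding d A_def B_def by (simp only: mult.assoc)
    qed
    moreover have "cnj w - w \<noteq> 0" using Im_w_pos by (simp add: complex_eq_iff)
    ultimately show ?thesis by simp
  qed
  have "conj_norm (\<lambda>r. \<eta> r * (A r * (B r * k r))) r = 1"
    unfolding conj_norm_def using one assms(7) sigma_in_roots by simp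
  then have eq: "conj_norm \<eta> r * (conj_norm A r * (conj_norm B r * conj_norm k r)) = 1" unfolding conj_norm_mult .
  have ge: "cmod (conj_norm \<eta> r) \<ge> 1" "cmod (conj_norm A r) \<ge> 1" "cmod (conj_norm B r) \<ge> 1" "cmod (conj_norm k r) \<ge> 1"
    using eq by (auto intro!: cmod_conj_norm_ge_1 assms fA fB k(1))
  have eq': "cmod (conj_norm \<eta> r) * (cmod (conj_norm A r) * (cmod (conj_norm B r) * cmod (conj_norm k r))) = 1"
    using arg_cong[OF eq, of cmod] by (simp add: norm_mult)
  have *: "x = 1" if "x * y = 1" "x \<ge> 1" "y \<ge> 1" for x y :: real
    using that mult_left_mono[of 1 y x] by simp
  have **: "1 \<le> x * y" if "x \<ge> 1" "y \<ge> 1" for x y :: real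
    using that mult_mono[of 1 x 1 y] by simp
  show "cmod (conj_norm \<eta> r) = 1" using *[OF eq'] ge ** by blast
  have "cmod (conj_norm A r) * (cmod (conj_norm \<eta> r) * (cmod (conj_norm B r) * cmod (conj_norm k r))) = 1" using eq' by (simp add: mult_ac)
  then have "cmod (conj_norm A r) = 1" using * ge ** by blast
  then show "cmod (conj_norm (\<lambda>r. cnj (\<theta> r) - \<theta> (\<sigma> r)) r) = 1" unfolding A_def .
qed

text \<open>The order of the theorem, see \<open>rel_order_eq\<close>; in this form the ring operations on it are those of
\<open>conj_family\<close>.\<close>

definition rel_order :: "complex \<Rightarrow> complex set" where "rel_order \<alpha> = {z \<alpha> | z. conj_family z}"

lemma rel_orderI: "conj_family z \<Longrightarrow> z \<alpha> \<in> rel_order \<alpha>"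
  unfolding rel_order_def by blast

text \<open>Every generator is of the expected form. The summand \<open>of_int (t*k) / 2\<close> is half an integer in general
and disappears for \<open>w = \<i>\<close>, where \<open>t = 0\<close>.\<close>

lemma generator_form:
  assumes "\<alpha> \<in> roots" "\<delta> \<ge> 3" "rel_order \<alpha> = int_adjoin \<theta>0"
  shows "\<delta> = 4 \<and> a \<in> {-3,-2,-1,0} \<and> (\<exists>b k::int. \<exists>r\<in>roots. \<exists>h\<in>{0,1}. \<exists>\<epsilon>\<in>{1,-1}. \<theta>0 = of_int b + of_int (t*k) / 2 + \<epsilon> * (w - cnj w) / 2 * (r + h))"
proof -
  obtain z where z: "conj_family z" "\<theta>0 = z \<alpha>"
    using int_adjoin_self[of \<theta>0] assms(3) unfolding rel_order_def by auto
  obtain u0 u1 u2 where u: "u0 \<in> quad_ints" "u1 \<in> quad_ints" "u2 \<in> quad_ints" "\<And>r. r \<in> roots \<Longrightarrow> z r = u0 + u1 * r + u2 * r^2" using z(1) by (rule conj_familyE) blast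
  obtain b0 b1 b2 y0 y1 y2 where bc: "u0 = of_int b0 + of_int y0 * w" "u1 = of_int b1 + of_int y1 * w" "u2 = of_int b2 + of_int y2 * w"
    using u(1-3) by (elim quad_ints_E)
  have "\<alpha> \<in> rel_order \<alpha>" "w \<in> rel_order \<alpha>" using rel_orderI[OF conj_family_id] rel_orderI[OF conj_family_const[OF quad_ints_w]] by simp_all
  then obtain p q where pq: "\<alpha> = poly (map_poly of_int p) (z \<alpha>)" "w = poly (map_poly of_int q) (z \<alpha>)"
    unfolding assms(3) z(2) int_adjoin_def by auto
  define \<eta> where "\<eta> r = of_int y0 + of_int y1 * r + of_int y2 * r^2" for r :: complex
  have eta_family: "conj_family \<eta>" by (rule conj_familyI[of "of_int y0" "of_int y1" "of_int y2"]) (simp_all add: \<eta>_def)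
  \<comment> \<open>Twice the real part and the normalised imaginary part of the generator; doubling clears the
    denominator that occurs for \<open>t = 1\<close>.\<close>
  define c0 c1 c2 where c: "c0 = 2*b0 + t*y0" "c1 = 2*b1 + t*y1" "c2 = 2*b2+t*y2"
  define e where "e x = of_int y0 + of_int y1 * x + of_int y2 * x^2" for x :: real
  define pp where "pp x = of_int c0 + of_int c1 * x + of_int c2 * x^2" for x :: real
  have z_form: "z r = of_real (pp (Re r)) / 2 + (w - cnj w) / 2 * of_real (e (Re r))" 
    and \<eta>_form: "\<eta> r = of_real (e (Re r))" if r: "r \<in> roots" for r
  proof -
    define x where "x = Re r"
    have rx: "r = of_real x" using roots_of_real[OF r] unfolding x_def .
    show "\<eta> r = of_real (e (Re r))" by (simp add: \<eta>_def e_def rx)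
    show "z r = of_real (pp (Re r)) / 2 + (w - cnj w) / 2 * of_real (e (Re r))"
      unfolding u(4)[OF r] bc unfolding rx c e_def pp_def cnj_w by (simp add: field_simps)
  qed
  have w_im: "w - cnj w = \<i> * of_real (2 * Im w)" by (simp add: complex_eq_iff)
  define v where "v = 2 * Im w"
  have v: "v^2 = of_int \<delta>" unfolding v_def by (rule Im_w_sq)
  have z_form': "z r = Complex (pp (Re r) / 2) (v / 2 * e (Re r))" if "r \<in> roots" for r
    unfolding z_form[OF that] w_im v_def by (simp add: complex_eq_iff)
  have diff: "z r - cnj (z r) = (w - cnj w) * \<eta> r" if "r \<in> roots" for r
    unfolding z_form'[OF that] \<eta>_form[OF that] w_im v_def by (simp add: complex_eq_iff)
  have un: "cmod (conj_norm \<eta> \<alpha>) = 1" "cmod (conj_norm (\<lambda>r. cnj (z r) - z (\<sigma> r)) \<alpha>) = 1"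
    using unit_norms[OF z(1) eta_family diff assms(1) pq assms(1)] by simp_all
  note bd = rel_index_bound[OF z(1) assms(1) pq(1) assms(1)]
  define x1 x2 x3 where x: "x1 = Re \<alpha>" "x2 = Re (\<sigma> \<alpha>)" "x3 = Re (\<sigma> (\<sigma> \<alpha>))"
  have roots3: "\<alpha> \<in> roots" "\<sigma> \<alpha> \<in> roots" "\<sigma> (\<sigma> \<alpha>) \<in> roots" using assms(1) sigma_in_roots by blast+
  have al: "\<alpha> = of_real x1" "\<sigma> \<alpha> = of_real x2" "\<sigma> (\<sigma> \<alpha>) = of_real x3"
    unfolding x using roots_of_real roots3 by blast+
  have "complex_of_real (x1 + x2 + x3) = of_real (of_int a)"
    "complex_of_real (x1*x2+x2*x3+x3*x1) = of_real (-(of_int a+3))"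
    "complex_of_real (x1*x2*x3) = of_real 1"
    using conj_rels[OF assms(1)] unfolding al(3) unfolding al(2) unfolding al(1) by simp_all
  then have rels: "x1 + x2 + x3 = of_int a" "x1*x2+x2*x3+x3*x1 = -(of_int a+3)" "x1*x2*x3 = 1"
    unfolding of_real_eq_iff .
  have indep: "b0 = 0 \<and> b1 = 0" if "x \<in> {x1,x2,x3}" "of_int b0 + of_int b1 * x = 0" for x :: real and b0 b1
  proof -
    have "of_real x \<in> roots" using that(1) roots3 al by auto
    from roots_independent[OF this, of b0 b1 0] that(2) show ?thesis by simp
  qed
  have sq1: "4 * (cmod (z r - z r'))^2 = (pp (Re r) - pp (Re r'))^2 + of_int \<delta> * (e (Re r) - e (Re r'))^2" if "r \<in> roots" "r' \<in> roots" for r r'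
    unfolding z_form'[OF that(1)] z_form'[OF that(2)] v[symmetric] cmod_power2 by (simp add: power2_eq_square field_simps)
  have sq2: "4 * (cmod (cnj (z r) - z r'))^2 = (pp (Re r) - pp (Re r'))^2 + of_int \<delta> * (e (Re r) + e (Re r'))^2" if "r \<in> roots" "r' \<in> roots" for r r'
    unfolding z_form'[OF that(1)] z_form'[OF that(2)] v[symmetric] cmod_power2 by (simp add: power2_eq_square field_simps)
  have "cmod (of_real (e x1) * of_real (e x2) * of_real (e x3)) = 1"
    using un(1) unfolding conj_norm_def \<eta>_form[OF roots3(1)] \<eta>_form[OF roots3(2)] \<eta>_form[OF roots3(3)] x .
  then have "\<bar>e x1 * e x2 * e x3\<bar> = 1" by (simp add: norm_mult abs_mult)
  then have N: "(e x1 * e x2 * e x3)^2 = 1" by (metis one_power2 power2_abs)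
  have "64 * (cmod (conj_norm (\<lambda>r. cnj (z r) - z (\<sigma> r)) \<alpha>))^2 =
     (4 * (cmod (cnj (z \<alpha>) - z (\<sigma> \<alpha>)))^2) * (4 * (cmod (cnj (z (\<sigma> \<alpha>)) - z (\<sigma> (\<sigma> \<alpha>))))^2) * (4 * (cmod (cnj (z (\<sigma> (\<sigma> \<alpha>))) - z \<alpha>))^2)"
    unfolding conj_norm_def by (simp add: norm_mult power_mult_distrib sigma_cubed[OF assms(1)])
  then have abs: "((pp x1 - pp x2)^2 + \<delta> * (e x1 + e x2)^2) * ((pp x2 - pp x3)^2 + \<delta> * (e x2 + e x3)^2) * ((pp x3 - pp x1)^2 + \<delta> * (e x3 + e x1)^2) = 64"
    unfolding un(2) sq2[OF roots3(1,2)] sq2[OF roots3(2,3)] sq2[OF roots3(3,1)] x by simp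
  have "64 * (cmod (conj_norm (\<lambda>r. z r - z (\<sigma> r)) \<alpha>))^2 =
     (4 * (cmod (z \<alpha> - z (\<sigma> \<alpha>)))^2) * (4 * (cmod (z (\<sigma> \<alpha>) - z (\<sigma> (\<sigma> \<alpha>))))^2) * (4 * (cmod (z (\<sigma> (\<sigma> \<alpha>)) - z \<alpha>))^2)"
    unfolding conj_norm_def by (simp add: norm_mult power_mult_distrib sigma_cubed[OF assms(1)])
  then have rel: "((pp x1 - pp x2)^2 + \<delta> * (e x1 - e x2)^2) * ((pp x2 - pp x3)^2 + \<delta> * (e x2 - e x3)^2) * ((pp x3 - pp x1)^2 + \<delta> * (e x3 - e x1)^2) \<le> 64 * m^2"
    unfolding sq1[OF roots3(1,2)] sq1[OF roots3(2,3)] sq1[OF roots3(3,1)] x using bd by simp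
  have "\<delta> = 4 \<and> c1 = 0 \<and> c2 = 0 \<and> a \<in> {-3,-2,-1,0} \<and>
    (\<exists>\<epsilon>\<in>{1,-1}. \<exists>h\<in>{0,1}. (\<epsilon> * e x1 - h)^3 = of_int a * (\<epsilon> * e x1 - h)^2 + of_int (a+3) * (\<epsilon> * e x1 - h) + 1)"
    by (rule real_coordinates_of_generator[OF rels _ assms(2) _ N[unfolded e_def] rel[unfolded e_def pp_def m_def] abs[unfolded e_def pp_def],
      folded m_def e_def pp_def]) (fact indep, fact m_ge)
  then have main: "\<delta> = 4" "c1 = 0" "c2 = 0" "a \<in> {-3,-2,-1,0}"
    "\<exists>\<epsilon>\<in>{1,-1}. \<exists>h\<in>{0,1}. (\<epsilon> * e x1 - h)^3 = of_int a * (\<epsilon> * e x1 - h)^2 + of_int (a+3) * (\<epsilon> * e x1 - h) + 1"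
    by simp_all
  from main(5) obtain \<epsilon> h where eh: "\<epsilon> \<in> {1,-1}" "h \<in> {0,1}" and cub: "(\<epsilon> * e x1 - h)^3 = of_int a * (\<epsilon> * e x1 - h)^2 + of_int (a+3) * (\<epsilon> * e x1 - h) + 1"
    by blast
  define r where "r = complex_of_real (\<epsilon> * e x1 - h)"
  have "r \<in> roots" unfolding roots_def r_def using arg_cong[OF cub, of complex_of_real] by simp
  moreover have "\<theta>0 = of_int b0 + of_int (t*y0) / 2 + of_real \<epsilon> * (w - cnj w) / 2 * (r + of_real h)"
    unfolding z(2) z_form[OF assms(1)] x[symmetric] using main(2,3) eh(1) by (auto simp: pp_def r_def c(1) add_divide_distrib)
  moreover have "complex_of_real h \<in> {0,1}" "complex_of_real \<epsilon> \<in> {1,-1}" using eh by auto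
  ultimately show ?thesis using main(1,4) by blast
qed

end

section \<open>Construction of generators\<close>

lemma map_poly_of_int_add: "map_poly of_int (p + q) = (map_poly of_int p + map_poly of_int q :: 'a::ring_1 poly)"
  by (rule poly_eqI) (simp add: coeff_map_poly)

lemma map_poly_of_int_mult: "map_poly of_int (p * q) = (map_poly of_int p * map_poly of_int q :: 'a::comm_ring_1 poly)"
  by (rule poly_eqI) (simp add: coeff_map_poly coeff_mult)

lemma int_adjoin_of_int: "of_int k \<in> int_adjoin \<theta>"
  unfolding int_adjoin_def by (intro CollectI exI[of _ "[:k:]"]) (simp add: map_poly_pCons)

lemma int_adjoin_add: "x \<in> int_adjoin \<theta> \<Longrightarrow> y \<in> int_adjoin \<theta> \<Longrightarrow> x + y \<in> int_adjoin \<theta>"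
  unfolding int_adjoin_def by (smt (verit, best) map_poly_of_int_add mem_Collect_eq poly_add)

lemma int_adjoin_mult: "x \<in> int_adjoin \<theta> \<Longrightarrow> y \<in> int_adjoin \<theta> \<Longrightarrow> x * y \<in> int_adjoin \<theta>"
  unfolding int_adjoin_def by (smt (verit, best) map_poly_of_int_mult mem_Collect_eq poly_mult)

lemma int_adjoin_uminus: "x \<in> int_adjoin \<theta> \<Longrightarrow> - x \<in> int_adjoin \<theta>"
  using int_adjoin_mult[OF int_adjoin_of_int[of "-1"], of x] by simp

lemma int_adjoin_diff: "x \<in> int_adjoin \<theta> \<Longrightarrow> y \<in> int_adjoin \<theta> \<Longrightarrow> x - y \<in> int_adjoin \<theta>"
  using int_adjoin_add[OF _ int_adjoin_uminus, of x \<theta> y] by simp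

text \<open>For exactly these parameters \<open>T S - N = \<plusminus>1\<close>, so the even powers of \<open>q\<close> span the same ring as all powers.
The coefficients are found by expressing \<open>q\<close> through \<open>1, q\<^sup>2, q\<^sup>4\<close> and substituting it into
\<open>1 / q = q\<^sup>2 - c q - (c + 3)\<close>.\<close>

lemma inverse_in_squares:
  fixes q :: complex and c :: int
  assumes "c \<in> {-3,-2,-1,0}" "q^3 = of_int c * q^2 + of_int (c+3) * q + 1"
  shows "\<exists>e0 e1 e2 :: int. q * (of_int e0 + of_int e1 * q^2 + of_int e2 * q^4) = 1"
proof -
  consider "c = -3" | "c = -2" | "c = -1" | "c = 0" using assms(1) by auto
  then show ?thesis
  proof cases
    case 1
    then have "q^3 = -3 * q^2 + 1" using assms(2) by simp
    then have "q * (9 + (-26) * q^2 + 3 * q^4) = 1" by algebra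
    then show ?thesis by (intro exI[of _ 9] exI[of _ "-26"] exI[of _ 3]) simp
  next
    case 2
    then have "q^3 = -2 * q^2 + q + 1" using assms(2) by simp
    then have "q * (-5 + 11 * q^2 + (-2) * q^4) = 1" by algebra
    then show ?thesis by (intro exI[of _ "-5"] exI[of _ "11"] exI[of _ "-2"]) simp
  next
    case 3
    then have "q^3 = -1 * q^2 + 2 * q + 1" using assms(2) by simp
    then have "q * (-3 + 4 * q^2 + (-1) * q^4) = 1" by algebra
    then show ?thesis by (intro exI[of _ "-3"] exI[of _ "4"] exI[of _ "-1"]) simp
  next
    case 4
    then have "q^3 = 3 * q + 1" using assms(2) by simp
    then have "q * (-3 + q^2 + 0 * q^4) = 1" by algebra
    then show ?thesis by (intro exI[of _ "-3"] exI[of _ "1"] exI[of _ "0"]) simp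
  qed
qed

text \<open>Multiplying the relation of \<open>inverse_in_squares\<close> by \<open>\<i>\<close> turns the even powers of \<open>q\<close> into even powers
of \<open>\<i> q\<close> with integer coefficients.\<close>

lemma i_in_int_adjoin:
  assumes "c \<in> {-3,-2,-1,0::int}" "q^3 = of_int c * q^2 + of_int (c+3) * q + 1" "\<i> * q \<in> int_adjoin \<theta>"
  shows "\<i> \<in> int_adjoin \<theta>"
proof -
  obtain e0 e1 e2 :: int where e: "q * (of_int e0 + of_int e1 * q^2 + of_int e2 * q^4) = 1"
    using inverse_in_squares[OF assms(1,2)] by blast
  let ?p = "\<i> * q"
  have "?p * (of_int e0 + of_int (-e1) * (?p*?p) + of_int e2 * (?p*?p*(?p*?p))) \<in> int_adjoin \<theta>"
    by (intro int_adjoin_add int_adjoin_mult int_adjoin_of_int assms(3))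
  also have "?p * (of_int e0 + of_int (-e1) * (?p*?p) + of_int e2 * (?p*?p*(?p*?p))) = \<i> * (q * (of_int e0 + of_int e1 * q^2 + of_int e2 * q^4))"
    by (simp add: algebra_simps power2_eq_square power4_eq_xxxx)
  finally show ?thesis unfolding e by simp
qed

context quad_cubic begin

lemma int_adjoin_subset_rel_order: "conj_family z \<Longrightarrow> int_adjoin (z \<alpha>) \<subseteq> rel_order \<alpha>"
  unfolding int_adjoin_def using rel_orderI[OF poly_family_eval[OF poly_family_of_int]] by blast

lemma rel_order_eq:
  "\<alpha> \<in> roots \<Longrightarrow> rel_order \<alpha> = {of_int x0 + of_int x1 * \<alpha> + of_int x2 * \<alpha> ^ 2
        + of_int y0 * w + of_int y1 * (w * \<alpha>) + of_int y2 * (w * \<alpha> ^ 2) | x0 x1 x2 y0 y1 y2 :: int. True}"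
  (is "_ \<Longrightarrow> _ = ?S")
proof (intro equalityI subsetI)
  fix x assume r: "\<alpha> \<in> roots" and "x \<in> rel_order \<alpha>"
  then obtain z where z: "conj_family z" "x = z \<alpha>" unfolding rel_order_def by auto
  obtain u0 u1 u2 where u: "u0 \<in> quad_ints" "u1 \<in> quad_ints" "u2 \<in> quad_ints" "\<And>r. r \<in> roots \<Longrightarrow> z r = u0 + u1 * r + u2 * r^2" using z(1) by (rule conj_familyE) blast
  obtain b0 b1 b2 y0 y1 y2 where bc: "u0 = of_int b0 + of_int y0 * w" "u1 = of_int b1 + of_int y1 * w" "u2 = of_int b2 + of_int y2 * w"
    using u(1-3) by (elim quad_ints_E)
  show "x \<in> ?S" unfolding z(2) u(4)[OF r] bc
    by (intro CollectI exI[of _ b0] exI[of _ b1] exI[of _ b2] exI[of _ y0] exI[of _ y1] exI[of _ y2]) (simp add: algebra_simps)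
next
  fix x assume "x \<in> ?S"
  then obtain x0 x1 x2 y0 y1 y2 :: int where x: "x = of_int x0 + of_int x1 * \<alpha> + of_int x2 * \<alpha> ^ 2
        + of_int y0 * w + of_int y1 * (w * \<alpha>) + of_int y2 * (w * \<alpha> ^ 2)" by blast
  have "conj_family (\<lambda>r. of_int x0 + of_int x1 * r + of_int x2 * r ^ 2 + of_int y0 * w + of_int y1 * (w * r) + of_int y2 * (w * r ^ 2))"
    unfolding power2_eq_square by (intro conj_family_add conj_family_mult conj_family_const conj_family_id) simp_all
  from rel_orderI[OF this, of \<alpha>] show "x \<in> rel_order \<alpha>" unfolding x .
qed

lemma rel_order_subset_int_adjoin:
  assumes "\<alpha> \<in> roots" "\<alpha> \<in> int_adjoin \<theta>" "w \<in> int_adjoin \<theta>" shows "rel_order \<alpha> \<subseteq> int_adjoin \<theta>"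
  unfolding rel_order_eq[OF assms(1)] power2_eq_square
  by (auto intro!: int_adjoin_add int_adjoin_mult int_adjoin_of_int assms)

lemma int_adjoin_sigma: "r \<in> int_adjoin \<theta> \<Longrightarrow> \<sigma> r \<in> int_adjoin \<theta>"
  unfolding \<sigma>_def power2_eq_square using int_adjoin_of_int[of 2]
  by (auto intro!: int_adjoin_diff int_adjoin_mult int_adjoin_of_int simp del: of_int_add)

lemma conjugate_in_int_adjoin:
  assumes "r \<in> roots" "\<alpha> \<in> roots" "r \<in> int_adjoin \<theta>" shows "\<alpha> \<in> int_adjoin \<theta>"
  using roots_factor[OF assms(1,2)] int_adjoin_sigma[OF assms(3)] int_adjoin_sigma[OF int_adjoin_sigma[OF assms(3)]] assms(3) by auto

lemma conjugate_in_rel_order: assumes "\<alpha> \<in> roots" "r \<in> roots" shows "r \<in> rel_order \<alpha>"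
  using roots_factor[OF assms] rel_orderI[OF conj_family_id, of \<alpha>] rel_orderI[OF conj_family_sigma, of \<alpha>] rel_orderI[OF conj_family_shift[OF conj_family_sigma], of \<alpha>] by auto

lemma generator_converse:
  assumes "w = \<i>" "a \<in> {-3,-2,-1,0}" "\<alpha> \<in> roots" "r \<in> roots" "h \<in> {0,1::complex}" "\<epsilon> \<in> {1,-1::complex}"
    and \<theta>: "\<theta> = of_int b + \<epsilon> * \<i> * (r + h)"
  shows "rel_order \<alpha> = int_adjoin \<theta>"
proof
  obtain z where z: "conj_family z" "r = z \<alpha>" using conjugate_in_rel_order[OF assms(3,4)] unfolding rel_order_def by auto
  have "conj_family (\<lambda>x. of_int b + \<epsilon> * w * (z x + h))"
    using assms(5,6) by (intro conj_family_add conj_family_mult conj_family_const z) auto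
  from int_adjoin_subset_rel_order[OF this] show "int_adjoin \<theta> \<subseteq> rel_order \<alpha>" unfolding \<theta> assms(1) z(2) .
  have "\<epsilon> * (\<theta> - of_int b) \<in> int_adjoin \<theta>"
    using assms(6) by (auto intro!: int_adjoin_diff int_adjoin_uminus int_adjoin_self int_adjoin_of_int)
  then have irh: "\<i> * (r + h) \<in> int_adjoin \<theta>" using assms(6) unfolding \<theta> by auto
  have i: "\<i> \<in> int_adjoin \<theta>"
  proof (cases "h = 0")
    case True
    then show ?thesis using i_in_int_adjoin[OF assms(2) roots_D[OF assms(4)]] irh by simp
  next
    case False
    then have h: "h = 1" using assms(5) by simp
    \<comment> \<open>\<open>-(r + 1)\<close> is a root of the simplest cubic with parameter \<open>-3 - a\<close>.\<close>
    let ?q = "-(r + 1)"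
    have "-3 - a \<in> {-3,-2,-1,0}" using assms(2) by auto
    moreover have "?q^3 = of_int (-3-a) * ?q^2 + of_int (-3-a+3) * ?q + 1"
      using roots_D[OF assms(4)] by (simp add: algebra_simps power2_eq_square power3_eq_cube)
    moreover have "\<i> * ?q \<in> int_adjoin \<theta>" using int_adjoin_uminus[OF irh] by (simp add: h algebra_simps)
    ultimately show ?thesis by (rule i_in_int_adjoin)
  qed
  have "h \<in> int_adjoin \<theta>"
    using assms(5) int_adjoin_of_int[of 0] int_adjoin_of_int[of 1] by auto
  from int_adjoin_diff[OF int_adjoin_uminus[OF int_adjoin_mult[OF i irh]] this]
  have "r \<in> int_adjoin \<theta>" by simp
  then show "rel_order \<alpha> \<subseteq> int_adjoin \<theta>"
    using rel_order_subset_int_adjoin[OF assms(3)] conjugate_in_int_adjoin[OF assms(4,3)] i assms(1) by simp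
qed

end

section \<open>The list of generators\<close>

lemma pib_quadruples_iff:
  assumes "a \<in> {-3,-2,-1,0}"
  shows "(a, y, X1, X2) \<in> pib_quadruples \<longleftrightarrow>
    (y \<in> {1,2} \<and> X1 = \<i> + of_int a * \<i> \<and> X2 = -\<i>) \<or> (y \<in> {0,1} \<and> X1 = \<i> \<and> X2 = 0) \<or>
    (y \<in> {-a-2,-a-3} \<and> X1 = - \<i> * of_int a \<and> X2 = \<i>)"
  using assms unfolding pib_quadruples_def by (elim insertE emptyE) auto

context quad_cubic begin

lemma quadruple_elements:
  assumes "\<alpha> \<in> roots" "a \<in> {-3,-2,-1,0}"
  shows "(\<exists>y X1 X2. (a, y, X1, X2) \<in> pib_quadruples \<and> \<gamma> = of_int y * \<i> + X1 * \<alpha> + X2 * \<alpha>^2) \<longleftrightarrow>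
    (\<exists>h\<in>{0,1}. \<gamma> = \<i> * (\<alpha> + h) \<or> \<gamma> = -\<i> * (\<sigma> \<alpha> + h) \<or> \<gamma> = -\<i> * (\<sigma> (\<sigma> \<alpha>) + h))"
  (is "?L \<longleftrightarrow> ?R")
proof -
  \<comment> \<open>The first and third families of quadruples belong to the other two roots, because
    \<open>\<sigma> \<alpha> = \<alpha>\<^sup>2 - (a + 1) \<alpha> - 2\<close> and \<open>\<sigma> (\<sigma> \<alpha>) = - \<alpha>\<^sup>2 + a \<alpha> + a + 2\<close>.\<close>
  have e1: "of_int y * \<i> + (\<i> + of_int a * \<i>) * \<alpha> + -\<i> * \<alpha>^2 = -\<i> * (\<sigma> \<alpha> + of_int (2 - y))" for y
    unfolding \<sigma>_def by (simp add: algebra_simps)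
  have e3: "of_int y * \<i> + (- \<i> * of_int a) * \<alpha> + \<i> * \<alpha>^2 = -\<i> * (\<sigma> (\<sigma> \<alpha>) + of_int (-a-2-y))" for y
    unfolding sigma_sigma[OF assms(1)] by (simp add: algebra_simps)
  show ?thesis
  proof
    assume ?L
    then obtain y X1 X2 where q: "(a, y, X1, X2) \<in> pib_quadruples" and g: "\<gamma> = of_int y * \<i> + X1 * \<alpha> + X2 * \<alpha>^2" by blast
    from q show ?R unfolding pib_quadruples_iff[OF assms(2)]
    proof (elim disjE conjE)
      assume "y \<in> {1,2}" "X1 = \<i> + of_int a * \<i>" "X2 = -\<i>"
      then have "complex_of_int (2 - y) \<in> {0,1}" "\<gamma> = -\<i> * (\<sigma> \<alpha> + of_int (2 - y))" using g e1[of y] by auto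
      then show ?R by blast
    next
      assume "y \<in> {0,1}" "X1 = \<i>" "X2 = 0"
      then have "complex_of_int y \<in> {0,1}" "\<gamma> = \<i> * (\<alpha> + of_int y)" using g by (auto simp: algebra_simps)
      then show ?R by blast
    next
      assume "y \<in> {-a-2,-a-3}" "X1 = - \<i> * of_int a" "X2 = \<i>"
      then have "complex_of_int (-a-2-y) \<in> {0,1}" "\<gamma> = -\<i> * (\<sigma> (\<sigma> \<alpha>) + of_int (-a-2-y))" using g e3[of y] by auto
      then show ?R by blast
    qed
  next
    assume ?R
    then obtain h where h: "h \<in> {0,1}" "\<gamma> = \<i> * (\<alpha> + h) \<or> \<gamma> = -\<i> * (\<sigma> \<alpha> + h) \<or> \<gamma> = -\<i> * (\<sigma> (\<sigma> \<alpha>) + h)" by blast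
    then obtain k :: int where k: "k \<in> {0,1}" "h = of_int k" by (metis insert_iff of_int_0 of_int_1 singletonD)
    from h(2) show ?L unfolding k(2)
    proof (elim disjE)
      assume "\<gamma> = \<i> * (\<alpha> + of_int k)"
      then have "\<gamma> = of_int k * \<i> + \<i> * \<alpha> + 0 * \<alpha>^2" by (simp add: algebra_simps)
      moreover have "(a, k, \<i>, 0) \<in> pib_quadruples" unfolding pib_quadruples_iff[OF assms(2)] using k(1) by blast
      ultimately show ?L by blast
    next
      assume "\<gamma> = -\<i> * (\<sigma> \<alpha> + of_int k)"
      then have "\<gamma> = of_int (2-k) * \<i> + (\<i> + of_int a * \<i>) * \<alpha> + -\<i> * \<alpha>^2" unfolding e1 by simp
      moreover have "(a, 2-k, \<i> + of_int a * \<i>, -\<i>) \<in> pib_quadruples" unfolding pib_quadruples_iff[OF assms(2)] using k(1) by auto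
      ultimately show ?L by blast
    next
      assume "\<gamma> = -\<i> * (\<sigma> (\<sigma> \<alpha>) + of_int k)"
      then have "\<gamma> = of_int (-a-2-k) * \<i> + (- \<i> * of_int a) * \<alpha> + \<i> * \<alpha>^2" unfolding e3 by simp
      moreover have "(a, -a-2-k, - \<i> * of_int a, \<i>) \<in> pib_quadruples" unfolding pib_quadruples_iff[OF assms(2)] using k(1) by auto
      ultimately show ?L by blast
    qed
  qed
qed

end

lemma quad_omega_relation:
  assumes "d > 0"
  obtains t n :: int where "quad_omega d^2 = of_int t * quad_omega d - of_int n" "Im (quad_omega d) > 0"
    "4 * n - t^2 \<ge> 3" "4 * n - t^2 = 4 \<Longrightarrow> d = 1 \<and> t = 0"
proof (cases "- int d mod 4 = 1")
  case True
  then have "\<exists>n. 4 * n = int d + 1" by presburger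
  then obtain n where n: "4 * n = int d + 1" by blast
  have "int d \<ge> 3" "int d \<noteq> 4" using True assms by presburger+
  have q: "quad_omega d = (1 + \<i> * of_real (sqrt (real d))) / 2" using True by (simp add: quad_omega_def)
  have "complex_of_int (4 * n) = of_int (int d + 1)" unfolding n ..
  then have n': "complex_of_int n = (of_nat d + 1) / 4" by (simp add: nonzero_eq_divide_eq mult.commute)
  then have "quad_omega d^2 = of_int 1 * quad_omega d - of_int n"
    unfolding q n' by (simp add: power2_eq_square field_simps flip: of_real_mult)
  moreover have "Im (quad_omega d) > 0" unfolding q using assms by simp
  ultimately show ?thesis using n \<open>int d \<ge> 3\<close> \<open>int d \<noteq> 4\<close> by (intro that[of 1 n]) auto
next
  case False
  then have q: "quad_omega d = \<i> * of_real (sqrt (real d))" by (simp add: quad_omega_def)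
  have "quad_omega d^2 = of_int 0 * quad_omega d - of_int (int d)"
    unfolding q by (simp add: power_mult_distrib flip: of_real_power)
  moreover have "Im (quad_omega d) > 0" unfolding q using assms by simp
  ultimately show ?thesis using assms by (intro that[of 0 "int d"]) auto
qed

theorem theorem3:
  fixes d :: nat and a :: int and \<alpha> :: complex
  assumes "d > 0" and "squarefree d"
    and "poly (simplest_cubic a) \<alpha> = 0"
  shows "(monogene (sextic_order d \<alpha>) \<longleftrightarrow> d = 1 \<and> a \<in> {-3, -2, -1, 0}) \<and>
    (d = 1 \<and> a \<in> {-3, -2, -1, 0} \<longrightarrow>
      (\<forall>\<theta>. generates_pib (sextic_order d \<alpha>) \<theta> \<longleftrightarrow>
        (\<exists>y X1 X2. (a, y, X1, X2) \<in> pib_quadruples \<and>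
          equivalent_elts \<theta> (of_int y * quad_omega d + X1 * \<alpha> + X2 * \<alpha> ^ 2))))"
proof -
  obtain t n :: int where tn: "quad_omega d^2 = of_int t * quad_omega d - of_int n" "Im (quad_omega d) > 0"
    "4 * n - t^2 \<ge> 3" "4 * n - t^2 = 4 \<Longrightarrow> d = 1 \<and> t = 0" using quad_omega_relation[OF assms(1)] by metis
  interpret quad_cubic "quad_omega d" t n a by unfold_locales (fact tn)+
  have \<alpha>: "\<alpha> \<in> roots" using assms(3) unfolding roots_def simplest_cubic_def
    by (simp add: algebra_simps power2_eq_square power3_eq_cube eq_neg_iff_add_eq_0)
  have O: "sextic_order d \<alpha> = rel_order \<alpha>" unfolding rel_order_eq[OF \<alpha>] sextic_order_def ..
  have w1: "quad_omega d = \<i>" if "d = 1" using that by (simp add: quad_omega_def)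
  have gen: "generates_pib (rel_order \<alpha>) \<theta> \<longleftrightarrow> d = 1 \<and> a \<in> {-3,-2,-1,0} \<and>
    (\<exists>b::int. \<exists>r\<in>roots. \<exists>h\<in>{0,1}. \<exists>\<epsilon>\<in>{1,-1}. \<theta> = of_int b + \<epsilon> * \<i> * (r + h))" (is "?L \<longleftrightarrow> ?R") for \<theta>
  proof
    assume ?L
    then have e: "rel_order \<alpha> = int_adjoin \<theta>" unfolding generates_pib_def by blast
    have "\<delta> \<ge> 3" using tn(3) unfolding \<delta>_def .
    from generator_form[OF \<alpha> this e] obtain b k r h \<epsilon> where
      g: "\<delta> = 4" "a \<in> {-3,-2,-1,0}" "r \<in> roots" "h \<in> {0,1}" "\<epsilon> \<in> {1,-1}"
      "\<theta> = of_int b + of_int (t*k) / 2 + \<epsilon> * (quad_omega d - cnj (quad_omega d)) / 2 * (r + h)"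
      by blast
    have dt: "d = 1" "t = 0" using tn(4) g(1) unfolding \<delta>_def by auto
    have "\<theta> = of_int b + \<epsilon> * \<i> * (r + h)" using g(6) unfolding w1[OF dt(1)] dt(2) by simp
    then show ?R using g dt by blast
  next
    assume ?R
    then obtain b r h \<epsilon> where g: "d = 1" "a \<in> {-3,-2,-1,0}" "r \<in> roots" "h \<in> {0,1}" "\<epsilon> \<in> {1,-1}"
      "\<theta> = of_int b + \<epsilon> * \<i> * (r + h)" by blast
    have "rel_order \<alpha> = int_adjoin \<theta>" by (rule generator_converse[OF w1[OF g(1)] g(2) \<alpha> g(3-6)])
    then show ?L unfolding generates_pib_def using int_adjoin_self by blast
  qed
  have mono: "monogene (rel_order \<alpha>) \<longleftrightarrow> d = 1 \<and> a \<in> {-3,-2,-1,0}"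
  proof
    assume "d = 1 \<and> a \<in> {-3,-2,-1,0}"
    then have "generates_pib (rel_order \<alpha>) (of_int 0 + 1 * \<i> * (\<alpha> + 0))" unfolding gen using \<alpha> by blast
    then show "monogene (rel_order \<alpha>)" unfolding monogene_def by blast
  qed (unfold monogene_def gen, blast)
  have list: "generates_pib (rel_order \<alpha>) \<theta> \<longleftrightarrow>
        (\<exists>y X1 X2. (a, y, X1, X2) \<in> pib_quadruples \<and>
          equivalent_elts \<theta> (of_int y * quad_omega d + X1 * \<alpha> + X2 * \<alpha> ^ 2))"
    if da: "d = 1" "a \<in> {-3, -2, -1, 0}" for \<theta>
  proof -
    have "(\<exists>y X1 X2. (a, y, X1, X2) \<in> pib_quadruples \<and>
          equivalent_elts \<theta> (of_int y * quad_omega d + X1 * \<alpha> + X2 * \<alpha> ^ 2)) \<longleftrightarrow>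
      (\<exists>\<gamma>. (\<exists>y X1 X2. (a, y, X1, X2) \<in> pib_quadruples \<and> \<gamma> = of_int y * \<i> + X1 * \<alpha> + X2 * \<alpha>^2) \<and> equivalent_elts \<theta> \<gamma>)"
      unfolding w1[OF da(1)] by blast
    also have "\<dots> \<longleftrightarrow> (\<exists>h\<in>{0,1}. equivalent_elts \<theta> (\<i> * (\<alpha> + h)) \<or> equivalent_elts \<theta> (-\<i> * (\<sigma> \<alpha> + h)) \<or> equivalent_elts \<theta> (-\<i> * (\<sigma> (\<sigma> \<alpha>) + h)))"
      unfolding quadruple_elements[OF \<alpha> da(2)] by blast
    also have "\<dots> \<longleftrightarrow> (\<exists>h\<in>{0,1}. \<exists>r\<in>{\<alpha>, \<sigma> \<alpha>, \<sigma> (\<sigma> \<alpha>)}. \<exists>b::int. \<theta> = of_int b + \<i> * (r + h) \<or> \<theta> = of_int b - \<i> * (r + h))"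
      unfolding equivalent_elts_def by auto
    also have "{\<alpha>, \<sigma> \<alpha>, \<sigma> (\<sigma> \<alpha>)} = roots" using roots_factor[OF \<alpha>] \<alpha> sigma_in_roots by blast
    also have "(\<exists>h\<in>{0,1}. \<exists>r\<in>roots. \<exists>b::int. \<theta> = of_int b + \<i> * (r + h) \<or> \<theta> = of_int b - \<i> * (r + h)) \<longleftrightarrow> generates_pib (rel_order \<alpha>) \<theta>"
      unfolding gen using da by auto
    finally show ?thesis ..
  qed
  show ?thesis unfolding O using mono list by blast
qed

end
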